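(* Let $u\in H^1(\Omega)$ be a solution of $\Delta u+k^2u=F_{\rho,D}$ in $\Omega$. Let $\omega\in S^2$ be regular with respect to $D$. Assume that $D$ has a circular cone singularity at $p(\omega)$ such that $D\cap B_\epsilon(p(\omega))=V_{p(\omega)}(-\mathbf n,\theta)\cap B_\epsilon(p(\omega))$ for some $\epsilon>0$, and that there are $\eta>0$, $0<\alpha\le1$ and $\tilde\rho\in C^{0,\alpha}(\overline{B_\eta(p(\omega))})$ with $\rho=\tilde\rho$ almost everywhere on $B_\eta(p(\omega))\cap D$. (i) Assume that $F_{\rho,D}$ is active at $p(\omega)$, i.e. that in addition $\tilde\rho(p(\omega))\neq0$. The vector $\omega$ coincides with $\mathbf n$ if and only if the function $I(\omega,\cdot)$ is a constant function on $S(\omega)$. (ii) The vector $\mathbf n$, the angle $\theta$ and the source strength $\tilde\rho(p(\omega))$ satisfy the two equations $$6\,|\tilde\rho(p(\omega))|\,V(\theta)=(\mathbf n\cdot\omega)^3\max_{\vartheta\in S(\omega)}|I(\omega,\vartheta)|,$$ $$6\,\tilde\rho(p(\omega))\,V(\theta)\,\bigl(3(\mathbf n\cdot\omega)^2-1\bigr)=\frac1\pi\int_{S(\omega)}I(\omega,\vartheta)\,ds(\vartheta).$$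
   Context: Setting. $\Omega\subset\mathbb R^3$ is a bounded domain with $C^2$ boundary; $k\ge 0$. $D$ is a nonempty open set with $\overline D\subset\Omega$, $\rho\in L^2(D)$ is complex-valued, and $F_{\rho,D}$ equals $\rho$ on $D$ and $0$ on $\Omega\setminus D$. Solutions $u\in H^1(\Omega)$ are weak and complex-valued, with no boundary condition prescribed. $S(\omega)=\{\vartheta\in S^2:\omega\cdot\vartheta=0\}$, with arc length $ds$. $h_D(\omega)=\sup_{x\in D}x\cdot\omega$. $\omega$ is regular with respect to $D$ if $\{x\in\overline D: x\cdot\omega=h_D(\omega)\}$ is a single point, denoted $p(\omega)$. $B_\epsilon(p)$ is the open ball of radius $\epsilon$ centered at $p$. For $p\in\mathbb R^3$, $\mathbf n\in S^2$, $\theta\in\,]0,\frac\pi2[$: $V_p(-\mathbf n,\theta)=\{x\in\mathbb R^3:(x-p)\cdot(-\mathbf n)>|x-p|\cos\theta\}$ and $V(\theta)=\frac\pi3\cos\theta\sin^2\theta$. $D$ has a circular cone singularity at $p\in\partial D$ if $D\cap B_\epsilon(p)=V_p(-\mathbf n,\theta)\cap B_\epsilon(p)$ for some $\epsilon>0$, $\mathbf n\in S^2$, $\theta\in\,]0,\frac\pi2[$. For $\delta>0$ and a nonempty bounded relatively open subset $Q$ of the plane $x\cdot\omega=p\cdot\omega-\delta$, let $D_{(p,\omega)}(\delta,Q)=\bigcup_{0<s<\delta}\{p+\frac{s}{\delta}(z-p): z\in Q\}$ and, for $\vartheta\in S(\omega)$, $$C_{(p,\omega)}(\delta,Q,\vartheta)=2s\int_{Q_s}\frac{dS_z}{\{s-i(z-p)\cdot\vartheta\}^3},\qquad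 Q_s=D_{(p,\omega)}(\delta,Q)\cap\{x: x\cdot\omega=p\cdot\omega-s\},$$ which does not depend on $s\in\,]0,\delta[$. If $\omega$ is regular and $D$ has a circular cone singularity at $p(\omega)$, with $D\cap B_\epsilon(p(\omega))=V_{p(\omega)}(-\mathbf n,\theta)\cap B_\epsilon(p(\omega))$ for some $\epsilon>0$, $\mathbf n\in S^2$, $\theta\in\,]0,\frac\pi2[$, then $\mathbf n\cdot\omega>\sin\theta$ and, for all sufficiently small $\delta>0$, $D\cap\{x:h_D(\omega)-\delta<x\cdot\omega<h_D(\omega)\}=D_{(p(\omega),\omega)}(\delta,Q)$ with $Q=V_{p(\omega)}(-\mathbf n,\theta)\cap\{x:x\cdot\omega=h_D(\omega)-\delta\}$. With such $\delta,Q$ (the choice is immaterial) define $$I(\omega,\vartheta)=\tilde\rho(p(\omega))\,C_{(p(\omega),\omega)}(\delta,Q,\vartheta),\qquad\vartheta\in S(\omega).$$ *)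

theory Defs
  imports "HOL-Analysis.Analysis"
begin

section \<open>Function spaces\<close>

definition partial_deriv :: "'n \<Rightarrow> (real^'n \<Rightarrow> 'b::real_normed_vector) \<Rightarrow> real^'n \<Rightarrow> 'b" where
  "partial_deriv i f x = frechet_derivative f (at x) (axis i 1)"

text \<open>Only used for open sets \<open>S\<close>.\<close>

primrec Ck_on :: "nat \<Rightarrow> (real^'n \<Rightarrow> 'b::real_normed_vector) \<Rightarrow> (real^'n) set \<Rightarrow> bool" where
  "Ck_on 0 f S \<longleftrightarrow> continuous_on S f"
| "Ck_on (Suc m) f S \<longleftrightarrow>
     (\<forall>x\<in>S. f differentiable (at x)) \<and> (\<forall>i. Ck_on m (partial_deriv i f) S)"

definition test_function :: "(real^'n) set \<Rightarrow> (real^'n \<Rightarrow> complex) \<Rightarrow> bool" where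
  "test_function \<Omega> \<phi> \<longleftrightarrow>
     (\<forall>m. Ck_on m \<phi> UNIV) \<and> compact (closure {x. \<phi> x \<noteq> 0}) \<and> closure {x. \<phi> x \<noteq> 0} \<subseteq> \<Omega>"

definition L2_on :: "(real^'n) set \<Rightarrow> (real^'n \<Rightarrow> complex) \<Rightarrow> bool" where
  "L2_on S f \<longleftrightarrow> set_borel_measurable lebesgue S f
                 \<and> set_integrable lebesgue S (\<lambda>x. (cmod (f x))\<^sup>2)"

definition weak_gradient_on ::
  "(real^'n) set \<Rightarrow> (real^'n \<Rightarrow> complex) \<Rightarrow> (real^'n \<Rightarrow> complex^'n) \<Rightarrow> bool" where
  "weak_gradient_on \<Omega> u g \<longleftrightarrow>
     (\<forall>\<phi> i. test_function \<Omega> \<phi> \<longrightarrow>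
        (LINT x:\<Omega>|lebesgue. u x * partial_deriv i \<phi> x) = - (LINT x:\<Omega>|lebesgue. g x $ i * \<phi> x))"

definition H1_with_gradient ::
  "(real^'n) set \<Rightarrow> (real^'n \<Rightarrow> complex) \<Rightarrow> (real^'n \<Rightarrow> complex^'n) \<Rightarrow> bool" where
  "H1_with_gradient \<Omega> u g \<longleftrightarrow>
     L2_on \<Omega> u \<and> (\<forall>i. L2_on \<Omega> (\<lambda>x. g x $ i)) \<and> weak_gradient_on \<Omega> u g"

text \<open>\<open>u\<close> lies in \<open>H\<^sup>1(\<Omega>)\<close> and solves \<open>\<Delta>u + k\<^sup>2 u = F\<close> in the weak sense; since all test functions
  have compact support in \<open>\<Omega>\<close>, no boundary condition is involved.\<close>

definition weak_helmholtz_solution ::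
  "(real^'n) set \<Rightarrow> real \<Rightarrow> (real^'n \<Rightarrow> complex) \<Rightarrow> (real^'n \<Rightarrow> complex) \<Rightarrow> bool" where
  "weak_helmholtz_solution \<Omega> k F u \<longleftrightarrow>
     (\<exists>g. H1_with_gradient \<Omega> u g \<and>
        (\<forall>\<phi>. test_function \<Omega> \<phi> \<longrightarrow>
           - (LINT x:\<Omega>|lebesgue. (\<Sum>i\<in>UNIV. g x $ i * partial_deriv i \<phi> x))
           + complex_of_real (k\<^sup>2) * (LINT x:\<Omega>|lebesgue. u x * \<phi> x)
           = (LINT x:\<Omega>|lebesgue. F x * \<phi> x)))"

definition holder_on :: "real \<Rightarrow> (real^'n) set \<Rightarrow> (real^'n \<Rightarrow> complex) \<Rightarrow> bool" where
  "holder_on \<alpha> S f \<longleftrightarrow> (\<exists>L. \<forall>x\<in>S. \<forall>y\<in>S. cmod (f x - f y) \<le> L * dist x y powr \<alpha>)"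

text \<open>Locally, in suitable Cartesian coordinates \<open>T\<close>, the set is the region strictly above the
  graph of a \<open>C\<^sup>2\<close> function.\<close>

definition C2_boundary :: "(real^3) set \<Rightarrow> bool" where
  "C2_boundary \<Omega> \<longleftrightarrow>
     (\<forall>x\<in>frontier \<Omega>. \<exists>r>0. \<exists>T :: real^3 \<Rightarrow> real^3. \<exists>\<gamma> :: real^2 \<Rightarrow> real.
        orthogonal_transformation T \<and> Ck_on 2 \<gamma> UNIV \<and>
        \<Omega> \<inter> ball x r = {y \<in> ball x r. \<gamma> (vector [T y $ 1, T y $ 2]) < T y $ 3})"

section \<open>Source support and its contact point\<close>

definition source :: "(real^3 \<Rightarrow> complex) \<Rightarrow> (real^3) set \<Rightarrow> real^3 \<Rightarrow> complex" where
  "source \<rho> D x = (if x \<in> D then \<rho> x else 0)"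

definition support_fun :: "(real^3) set \<Rightarrow> real^3 \<Rightarrow> real" where
  "support_fun D \<omega> = (SUP x\<in>D. x \<bullet> \<omega>)"

definition contact_set :: "(real^3) set \<Rightarrow> real^3 \<Rightarrow> (real^3) set" where
  "contact_set D \<omega> = {x \<in> closure D. x \<bullet> \<omega> = support_fun D \<omega>}"

definition regular_direction :: "(real^3) set \<Rightarrow> real^3 \<Rightarrow> bool" where
  "regular_direction D \<omega> \<longleftrightarrow> is_singleton (contact_set D \<omega>)"

definition contact_point :: "(real^3) set \<Rightarrow> real^3 \<Rightarrow> real^3" where
  "contact_point D \<omega> = the_elem (contact_set D \<omega>)"

section \<open>Circular cones\<close>

text \<open>The open cone with vertex \<open>p\<close>, axis direction \<open>v\<close> and half-angle \<open>\<theta>\<close>.\<close>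

definition circular_cone :: "real^3 \<Rightarrow> real^3 \<Rightarrow> real \<Rightarrow> (real^3) set" where
  "circular_cone p v \<theta> = {x. (x - p) \<bullet> v > norm (x - p) * cos \<theta>}"

definition cone_volume :: "real \<Rightarrow> real" where
  "cone_volume \<theta> = pi / 3 * cos \<theta> * (sin \<theta>)\<^sup>2"

definition cone_singularity :: "(real^3) set \<Rightarrow> real^3 \<Rightarrow> real^3 \<Rightarrow> real \<Rightarrow> bool" where
  "cone_singularity D p n \<theta> \<longleftrightarrow>
     p \<in> frontier D \<and> n \<in> sphere 0 1 \<and> 0 < \<theta> \<and> \<theta> < pi / 2 \<and>
     (\<exists>\<epsilon>>0. D \<inter> ball p \<epsilon> = circular_cone p (- n) \<theta> \<inter> ball p \<epsilon>)"

section \<open>Surface measure on a plane and arc length on a great circle\<close>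

definition orthogonal_circle :: "real^3 \<Rightarrow> (real^3) set" where
  "orthogonal_circle \<omega> = {\<xi> \<in> sphere 0 1. \<omega> \<bullet> \<xi> = 0}"

definition normal_frame :: "real^3 \<Rightarrow> real^3 \<Rightarrow> real^3 \<Rightarrow> bool" where
  "normal_frame \<omega> a b \<longleftrightarrow>
     a \<in> orthogonal_circle \<omega> \<and> b \<in> orthogonal_circle \<omega> \<and> a \<bullet> b = 0"

definition frame_map :: "real^3 \<Rightarrow> real^3 \<Rightarrow> real \<Rightarrow> real^3 \<Rightarrow> real^2 \<Rightarrow> real^3" where
  "frame_map a b c \<omega> y = c *\<^sub>R \<omega> + (y $ 1) *\<^sub>R a + (y $ 2) *\<^sub>R b"

text \<open>For a unit vector \<open>\<omega>\<close>: the surface measure of the plane \<open>{x. x \<bullet> \<omega> = c}\<close>, transported from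
  planar Lebesgue measure by isometric coordinates, and the arc length measure of the great circle
  orthogonal to \<open>\<omega>\<close>, transported by the unit speed parametrization. Neither depends on the
  orthonormal frame chosen.\<close>

definition chosen_frame :: "real^3 \<Rightarrow> (real^3) \<times> (real^3)" where
  "chosen_frame \<omega> = (SOME (a, b). normal_frame \<omega> a b)"

definition plane_measure :: "real^3 \<Rightarrow> real \<Rightarrow> (real^3) measure" where
  "plane_measure \<omega> c = (case chosen_frame \<omega> of (a, b) \<Rightarrow> distr lborel borel (frame_map a b c \<omega>))"

definition arc_length_measure :: "real^3 \<Rightarrow> (real^3) measure" where
  "arc_length_measure \<omega> = (case chosen_frame \<omega> of (a, b) \<Rightarrow>
     distr (restrict_space lborel {0..<2 * pi}) borel (\<lambda>t. cos t *\<^sub>R a + sin t *\<^sub>R b))"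

section \<open>The indicator function\<close>

definition plane_at_depth :: "real^3 \<Rightarrow> real^3 \<Rightarrow> real \<Rightarrow> (real^3) set" where
  "plane_at_depth p \<omega> s = {x. x \<bullet> \<omega> = p \<bullet> \<omega> - s}"

definition conical_region :: "real^3 \<Rightarrow> real \<Rightarrow> (real^3) set \<Rightarrow> (real^3) set" where
  "conical_region p \<delta> Q = (\<Union>s\<in>{0<..<\<delta>}. {p + (s / \<delta>) *\<^sub>R (z - p) | z. z \<in> Q})"

definition cross_section_integral ::
  "real^3 \<Rightarrow> real^3 \<Rightarrow> real \<Rightarrow> (real^3) set \<Rightarrow> real^3 \<Rightarrow> real \<Rightarrow> complex" where
  "cross_section_integral p \<omega> \<delta> Q \<xi> s =
     2 * complex_of_real s *
     (LINT z:conical_region p \<delta> Q \<inter> plane_at_depth p \<omega> s|plane_measure \<omega> (p \<bullet> \<omega> - s).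
        1 / (complex_of_real s - \<i> * complex_of_real ((z - p) \<bullet> \<xi>)) ^ 3)"

text \<open>The common value of the preceding expression for all \<open>s\<close> in \<open>]0, \<delta>[\<close>; by scaling it does not
  depend on \<open>s\<close>.\<close>

definition C_coeff :: "real^3 \<Rightarrow> real^3 \<Rightarrow> real \<Rightarrow> (real^3) set \<Rightarrow> real^3 \<Rightarrow> complex" where
  "C_coeff p \<omega> \<delta> Q \<xi> =
     (THE c. \<forall>s\<in>{0<..<\<delta>}. cross_section_integral p \<omega> \<delta> Q \<xi> s = c)"

definition cone_slice :: "real^3 \<Rightarrow> real^3 \<Rightarrow> real \<Rightarrow> real^3 \<Rightarrow> real \<Rightarrow> (real^3) set" where
  "cone_slice p n \<theta> \<omega> \<delta> = circular_cone p (- n) \<theta> \<inter> plane_at_depth p \<omega> \<delta>"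

definition admissible_depth ::
  "(real^3) set \<Rightarrow> real^3 \<Rightarrow> real^3 \<Rightarrow> real \<Rightarrow> real \<Rightarrow> bool" where
  "admissible_depth D \<omega> n \<theta> \<delta> \<longleftrightarrow> \<delta> > 0 \<and>
     D \<inter> {x. support_fun D \<omega> - \<delta> < x \<bullet> \<omega> \<and> x \<bullet> \<omega> < support_fun D \<omega>} =
     conical_region (contact_point D \<omega>) \<delta> (cone_slice (contact_point D \<omega>) n \<theta> \<omega> \<delta>)"

text \<open>\<open>f\<close> is the extension of the source strength near the contact point. The value is the common
  one for all admissible depths.\<close>

definition I_fun ::
  "(real^3) set \<Rightarrow> (real^3 \<Rightarrow> complex) \<Rightarrow> real^3 \<Rightarrow> real \<Rightarrow> real^3 \<Rightarrow> real^3 \<Rightarrow> complex" where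
  "I_fun D f n \<theta> \<omega> \<xi> =
     (THE c. \<forall>\<delta>. admissible_depth D \<omega> n \<theta> \<delta> \<longrightarrow>
        f (contact_point D \<omega>) *
        C_coeff (contact_point D \<omega>) \<omega> \<delta> (cone_slice (contact_point D \<omega>) n \<theta> \<omega> \<delta>) \<xi> = c)"

end

theory Submission
  imports Defs
begin

text \<open>
  Everything follows from a closed form of the indicator function: with the contact point \<open>p\<close>,
  \<open>I \<xi> = 6 \<rho>'(p) V(\<theta>) / (n \<bullet> \<omega> + \<i> (n \<bullet> \<xi>))\<^sup>3\<close> for every \<open>\<xi>\<close> in the great circle orthogonal to \<open>\<omega>\<close>
  (lemma \<open>I_fun_cone\<close>).
  Since \<open>n \<bullet> \<omega> > 0\<close>, its modulus is largest where \<open>n \<bullet> \<xi> = 0\<close>, which gives the first equation, and for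
  \<open>\<rho>'(p) \<noteq> 0\<close> it is constant only if \<open>n\<close> is orthogonal to the whole circle, that is, \<open>n = \<omega>\<close>. The integral
  over the circle is, up to the constant factor, Laplace's integral for the Legendre polynomial \<open>P\<^sub>2\<close>,
  \<open>(1 / \<pi>) \<integral> (c + \<i> sqrt (1 - c\<^sup>2) cos t)\<^sup>-\<^sup>3 dt = 2 P\<^sub>2(c)\<close>, taken over a full period with
  \<open>c = n \<bullet> \<omega>\<close>, where \<open>2 P\<^sub>2(c) = 3 c\<^sup>2 - 1\<close>; this is the second equation.

  The closed form is a computation in the plane at depth \<open>s\<close> below \<open>p\<close>. If the first coordinate axis points
  along \<open>\<xi>\<close>, then the kernel depends on one coordinate only, and the cross-section is an ellipse because
  \<open>n \<bullet> \<omega> > sin \<theta>\<close>. Integrating over chords leaves a one-dimensional integral of \<open>sqrt (r\<^sup>2 - (x - m)\<^sup>2)\<close>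
  against \<open>(s - \<i> x)\<^sup>-\<^sup>3\<close>, which a trigonometric substitution turns into integrals of powers of
  \<open>1 / (\<alpha> + \<i> R cos t)\<close> (lemma \<open>integral_inverse_cube_ellipse\<close>). These in turn all come from the integral
  of the first power, \<open>2 \<pi> / sqrt (\<alpha>\<^sup>2 + R\<^sup>2)\<close> (lemma \<open>has_integral_inverse_angular\<close>); the geometry of the cone
  makes \<open>\<alpha>\<^sup>2 + R\<^sup>2\<close> a perfect square.

  The geometric input, \<open>n \<bullet> \<omega> > sin \<theta>\<close> and the existence of an admissible depth, expresses that the closed
  cone touches the supporting plane only at its vertex (lemma \<open>contact_cone_below_plane\<close>), which is
  what regularity of \<open>\<omega>\<close> provides.
\<close>

section \<open>Angular integrals of inverse powers\<close>

lemma has_integral_periodic_derivative: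
  fixes F :: "real \<Rightarrow> complex"
  assumes "\<And>t. (F has_vector_derivative f t) (at t)" and "F (2 * pi) = F 0"
  shows "(f has_integral 0) {0..2 * pi}"
  using fundamental_theorem_of_calculus[of 0 "2 * pi" F f] assms
  by (auto intro: has_vector_derivative_at_within)

lemma rotated_pair_square_sum:
  fixes x y t :: real
  shows "(x * cos t + y * sin t)\<^sup>2 + (y * cos t - x * sin t)\<^sup>2 = x\<^sup>2 + y\<^sup>2"
proof -
  have "(x * cos t + y * sin t)\<^sup>2 + (y * cos t - x * sin t)\<^sup>2
      = (x\<^sup>2 + y\<^sup>2) * ((sin t)\<^sup>2 + (cos t)\<^sup>2)" by algebra
  then show ?thesis by simp
qed

lemma has_vector_derivative_quotient:
  fixes f g :: "real \<Rightarrow> complex"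
  assumes "(f has_vector_derivative f') (at t within S)" "(g has_vector_derivative g') (at t within S)"
    and "g t \<noteq> 0"
  shows "((\<lambda>t. f t / g t) has_vector_derivative (f' * g t - f t * g') / (g t)\<^sup>2) (at t within S)"
  using has_derivative_divide'[OF assms(1,2)[unfolded has_vector_derivative_def] assms(3)]
  unfolding has_vector_derivative_def
  by (rule has_derivative_eq_rhs) (auto simp: fun_eq_iff power2_eq_square scaleR_conv_of_real algebra_simps)

text \<open>
  Write \<open>v t = b1 cos t + b2 sin t\<close>, \<open>\<beta> = b1\<^sup>2 + b2\<^sup>2\<close>, and deform the denominator to \<open>u r = \<alpha> + \<i> r v\<close> with
  \<open>r\<close> running from \<open>0\<close> to \<open>1\<close>. The integral \<open>f r\<close> of \<open>1 / u r\<close> over a period satisfies the linear equation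
  \<open>f' (\<alpha>\<^sup>2 + r\<^sup>2 \<beta>) + r \<beta> f = 0\<close>, because the corresponding combination of integrands is the derivative of the
  periodic function \<open>\<i> \<alpha> v' / u r\<close>. Hence \<open>f\<^sup>2 (\<alpha>\<^sup>2 + r\<^sup>2 \<beta>)\<close> is constant, which gives the square of the
  integral. Positivity of the real part selects the root, so no branch of a complex logarithm or square
  root has to be followed.
\<close>

lemma has_integral_inverse_angular:
  fixes \<alpha> Z :: complex and b1 b2 :: real
  assumes \<alpha>: "Re \<alpha> > 0" and Z: "Re Z > 0" "Z\<^sup>2 = \<alpha>\<^sup>2 + of_real (b1\<^sup>2 + b2\<^sup>2)"
  shows "((\<lambda>t. 1 / (\<alpha> + \<i> * of_real (b1 * cos t + b2 * sin t))) has_integral 2 * of_real pi / Z) {0..2 * pi}"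
proof -
  define v where "v t = b1 * cos t + b2 * sin t" for t
  define v' where "v' t = b2 * cos t - b1 * sin t" for t
  define \<beta> where "\<beta> = b1\<^sup>2 + b2\<^sup>2"
  define u where "u r t = \<alpha> + \<i> * of_real (r * v t)" for r t
  define Q where "Q r = \<alpha>\<^sup>2 + of_real (r\<^sup>2 * \<beta>)" for r
  define f where "f r = integral {0..2 * pi} (\<lambda>t. 1 / u r t)" for r
  define f' where "f' r = integral {0..2 * pi} (\<lambda>t. - (\<i> * of_real (v t)) / (u r t)\<^sup>2)" for r
  have Reu: "Re (u r t) = Re \<alpha>" for r t by (simp add: u_def)
  then have u0: "u r t \<noteq> 0" for r t using \<alpha> by (metis less_irrefl zero_complex.simps(1))
  have \<alpha>0: "\<alpha> \<noteq> 0" using \<alpha> by auto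
  have trig: "v t ^ 2 + v' t ^ 2 = \<beta>" for t
    unfolding v_def v'_def \<beta>_def by (rule rotated_pair_square_sum)
  have dv: "(v has_real_derivative v' t) (at t)" for t
    unfolding v_def v'_def by (auto intro!: derivative_eq_intros)
  have dv': "(v' has_real_derivative - v t) (at t)" for t
    unfolding v_def v'_def by (auto intro!: derivative_eq_intros)
  have contv: "continuous_on S v" for S unfolding v_def by (intro continuous_intros)
  have cont1: "continuous_on {0..2 * pi} (\<lambda>t. 1 / u r t)" for r
    using u0 unfolding u_def by (intro continuous_intros contv) auto
  have cont2: "continuous_on {0..2 * pi} (\<lambda>t. - (\<i> * of_real (v t)) / (u r t)\<^sup>2)" for r
    using u0 unfolding u_def by (intro continuous_intros contv) auto
  have int1: "((\<lambda>t. 1 / u r t) has_integral f r) {0..2 * pi}" for r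
    unfolding f_def by (intro integrable_integral integrable_continuous_real cont1)
  have int2: "((\<lambda>t. - (\<i> * of_real (v t)) / (u r t)\<^sup>2) has_integral f' r) {0..2 * pi}" for r
    unfolding f'_def by (intro integrable_integral integrable_continuous_real cont2)
  have df: "(f has_vector_derivative f' r) (at r within {0..1})" if "r \<in> {0..1}" for r
  proof -
    have "((\<lambda>r. integral (cbox 0 (2 * pi)) (\<lambda>t. 1 / u r t)) has_vector_derivative
        integral (cbox 0 (2 * pi)) (\<lambda>t. - (\<i> * of_real (v t)) / (u r t)\<^sup>2)) (at r within {0..1})"
    proof (rule leibniz_rule_vector_derivative)
    show "((\<lambda>r. 1 / u r t) has_vector_derivative - (\<i> * of_real (v t)) / (u r t)\<^sup>2) (at r within {0..1})" for r t
    proof -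
      have "((\<lambda>r. u r t) has_vector_derivative \<i> * of_real (v t)) (at r within {0..1})"
        unfolding u_def by (auto intro!: derivative_eq_intros)
      from has_vector_derivative_quotient[OF has_vector_derivative_const this u0, of 1] show ?thesis
        by simp
    qed
    show "(\<lambda>t. 1 / u r t) integrable_on cbox 0 (2 * pi)" for r
      using cont1 by (simp add: integrable_continuous_real)
    have "continuous_on ({0..1} \<times> cbox 0 (2 * pi)) (\<lambda>p. - (\<i> * of_real (v (snd p))) / (u (fst p) (snd p))\<^sup>2)"
      using u0 unfolding u_def v_def
      by (intro continuous_intros) auto
    then show "continuous_on ({0..1} \<times> cbox 0 (2 * pi)) (\<lambda>(r, t). - (\<i> * of_real (v t)) / (u r t)\<^sup>2)"
      by (simp add: case_prod_unfold)
    qed (use that in auto)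
    then show ?thesis unfolding f_def f'_def by simp
  qed
  have ode: "f' r * Q r + of_real (r * \<beta>) * f r = 0" for r
  proof -
    have "((\<lambda>t. (- (\<i> * of_real (v t)) / (u r t)\<^sup>2) * Q r + of_real (r * \<beta>) * (1 / u r t)) has_integral 0) {0..2 * pi}"
    proof (rule has_integral_periodic_derivative)
      fix t
      have du: "((\<lambda>t. u r t) has_vector_derivative \<i> * of_real (r * v' t)) (at t)"
        unfolding u_def by (auto intro!: derivative_eq_intros has_vector_derivative_of_real dv)
      have "((\<lambda>t. \<i> * \<alpha> * of_real (v' t)) has_vector_derivative \<i> * \<alpha> * of_real (- v t)) (at t)"
        by (auto intro!: derivative_eq_intros has_vector_derivative_of_real dv')
      from has_vector_derivative_quotient[OF this du u0]
      have "((\<lambda>t. \<i> * \<alpha> * of_real (v' t) / u r t) has_vector_derivative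
         (\<i> * \<alpha> * of_real (- v t) * u r t - \<i> * \<alpha> * of_real (v' t) * (\<i> * of_real (r * v' t))) / (u r t)\<^sup>2) (at t)" .
      moreover have "(\<i> * \<alpha> * of_real (- v t) * u r t - \<i> * \<alpha> * of_real (v' t) * (\<i> * of_real (r * v' t))) / (u r t)\<^sup>2
        = (- (\<i> * of_real (v t)) / (u r t)\<^sup>2) * Q r + of_real (r * \<beta>) * (1 / u r t)"
      proof -
        have i2: "\<i> * \<i> = (-1::complex)" by simp
        have tr: "of_real (v t) ^ 2 + of_real (v' t) ^ 2 = (of_real \<beta> :: complex)"
          using trig[of t] by (metis of_real_add of_real_power)
        have "\<i> * \<alpha> * of_real (- v t) * u r t - \<i> * \<alpha> * of_real (v' t) * (\<i> * of_real (r * v' t))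
          = - (\<i> * of_real (v t)) * Q r + of_real (r * \<beta>) * u r t"
          unfolding u_def Q_def of_real_mult of_real_power of_real_minus using i2 tr by algebra
        then have "(\<i> * \<alpha> * of_real (- v t) * u r t - \<i> * \<alpha> * of_real (v' t) * (\<i> * of_real (r * v' t))) / (u r t)\<^sup>2
          = (- (\<i> * of_real (v t)) * Q r + of_real (r * \<beta>) * u r t) / (u r t)\<^sup>2" by simp
        also have "\<dots> = (- (\<i> * of_real (v t)) / (u r t)\<^sup>2) * Q r + of_real (r * \<beta>) * (1 / u r t)"
          using u0[of r t] by (simp add: field_simps power2_eq_square)
        finally show ?thesis .
      qed
      ultimately show "((\<lambda>t. \<i> * \<alpha> * of_real (v' t) / u r t) has_vector_derivative
         (- (\<i> * of_real (v t)) / (u r t)\<^sup>2) * Q r + of_real (r * \<beta>) * (1 / u r t)) (at t)"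
        by simp
    qed (simp add: u_def v'_def v_def)
    moreover have "((\<lambda>t. (- (\<i> * of_real (v t)) / (u r t)\<^sup>2) * Q r + of_real (r * \<beta>) * (1 / u r t)) has_integral
       f' r * Q r + of_real (r * \<beta>) * f r) {0..2 * pi}"
      by (intro has_integral_add has_integral_mult_left has_integral_mult_right int1 int2)
    ultimately show ?thesis using has_integral_unique by blast
  qed
  \<comment> \<open>The equation makes the derivative \<open>2 f (f' Q + r \<beta> f)\<close> of \<open>f\<^sup>2 Q\<close> vanish.\<close>
  have "(f 1)\<^sup>2 * Q 1 = (f 0)\<^sup>2 * Q 0"
  proof -
    have "((\<lambda>r. (f r)\<^sup>2 * Q r) has_vector_derivative 0) (at r within {0..1})" if "r \<in> {0..1}" for r
    proof -
      have "(Q has_vector_derivative of_real (2 * r * \<beta>)) (at r within {0..1})"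
      proof -
        have "((\<lambda>r. r\<^sup>2 * \<beta>) has_real_derivative 2 * r * \<beta>) (at r within {0..1})"
          by (auto intro!: derivative_eq_intros)
        from has_vector_derivative_add[OF has_vector_derivative_const has_vector_derivative_of_real[OF this]]
        show ?thesis unfolding Q_def by simp
      qed
      from has_vector_derivative_mult[OF has_vector_derivative_mult[OF df[OF that] df[OF that]] this]
      have "((\<lambda>r. (f r)\<^sup>2 * Q r) has_vector_derivative
          2 * f r * (f' r * Q r + of_real (r * \<beta>) * f r)) (at r within {0..1})"
        by (simp add: power2_eq_square algebra_simps)
      then show ?thesis by (simp only: ode mult_zero_right)
    qed
    then obtain c where "\<And>r. r \<in> {0..1} \<Longrightarrow> (f r)\<^sup>2 * Q r = c"
      using has_vector_derivative_zero_constant[of "{0..1}" "\<lambda>r. (f r)\<^sup>2 * Q r"] by auto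
    then show ?thesis by simp
  qed
  moreover have "f 0 = 2 * of_real pi / \<alpha>"
    unfolding f_def by (simp add: u_def scaleR_conv_of_real)
  moreover have "Q 0 = \<alpha>\<^sup>2" "Q 1 = Z\<^sup>2" using Z by (auto simp: Q_def \<beta>_def)
  ultimately have "(f 1 * Z)\<^sup>2 = (2 * of_real pi)\<^sup>2"
    using \<alpha>0 by (simp add: power_mult_distrib power_divide)
  then have "f 1 * Z = 2 * of_real pi \<or> f 1 * Z = - (2 * of_real pi)"
    using power2_eq_iff by blast
  moreover have "Z \<noteq> 0" using Z by auto
  ultimately have "f 1 = 2 * of_real pi / Z \<or> f 1 = - (2 * of_real pi / Z)"
    by (auto simp: field_simps)
  moreover have "Re (f 1) \<ge> 0"
  proof -
    have "((\<lambda>t. Re (1 / u 1 t)) has_integral Re (f 1)) {0..2 * pi}"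
      using has_integral_linear[OF int1 bounded_linear_Re] by (simp add: o_def)
    moreover have "Re (1 / u 1 t) \<ge> 0" for t
      using Reu[of 1 t] \<alpha> by (simp add: Re_divide)
    ultimately show ?thesis by (meson has_integral_nonneg)
  qed
  moreover have "Re (2 * of_real pi / Z) > 0"
    using Z(1) by (auto simp: Re_divide intro!: divide_pos_pos add_pos_nonneg)
  ultimately have "f 1 = 2 * of_real pi / Z" by auto
  then show ?thesis using int1[of 1] by (simp add: u_def v_def)
qed
text \<open>
  Integration by parts over a period: the derivatives of the periodic functions \<open>u' / u\<close> and \<open>u' / u\<^sup>2\<close> are
  \<open>- \<alpha> / u + Z\<^sup>2 / u\<^sup>2\<close> and \<open>1 / u - 3 \<alpha> / u\<^sup>2 + 2 Z\<^sup>2 / u\<^sup>3\<close>, and their vanishing integrals reduce the powers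
  two and three to the first power. For \<open>Z = 1\<close> the second formula is Laplace's integral for the Legendre
  polynomial of degree two.
\<close>

lemma has_integral_inverse_powers_angular:
  fixes \<alpha> Z :: complex and b1 b2 :: real
  assumes \<alpha>: "Re \<alpha> > 0" and Z: "Re Z > 0" "Z\<^sup>2 = \<alpha>\<^sup>2 + of_real (b1\<^sup>2 + b2\<^sup>2)"
  defines "u \<equiv> \<lambda>t. \<alpha> + \<i> * of_real (b1 * cos t + b2 * sin t)"
  shows "((\<lambda>t. 1 / u t ^ 2) has_integral 2 * of_real pi * \<alpha> / Z ^ 3) {0..2 * pi}" (is ?I2)
    and "((\<lambda>t. 1 / u t ^ 3) has_integral of_real pi * (3 * \<alpha>\<^sup>2 - Z\<^sup>2) / Z ^ 5) {0..2 * pi}" (is ?I3)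
proof -
  define v where "v t = b1 * cos t + b2 * sin t" for t
  define v' where "v' t = b2 * cos t - b1 * sin t" for t
  define \<beta> where "\<beta> = b1\<^sup>2 + b2\<^sup>2"
  have u: "u t = \<alpha> + \<i> * of_real (v t)" for t by (simp add: u_def v_def)
  have u0: "u t \<noteq> 0" for t
  proof -
    have "Re (u t) > 0" using \<alpha> by (simp add: u)
    then show ?thesis by force
  qed
  have Z0: "Z \<noteq> 0" using Z by auto
  have trig: "v t ^ 2 + v' t ^ 2 = \<beta>" for t
    unfolding v_def v'_def \<beta>_def by (rule rotated_pair_square_sum)
  have i2: "\<i> * \<i> = (-1::complex)" by simp
  have tr: "of_real (v t) ^ 2 + of_real (v' t) ^ 2 = (of_real \<beta> :: complex)" for t
    using trig[of t] by (metis of_real_add of_real_power)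
  have ZQ: "Z\<^sup>2 = \<alpha>\<^sup>2 + of_real \<beta>" using Z by (simp add: \<beta>_def)
  have "(v has_real_derivative v' t) (at t)" for t
    unfolding v_def v'_def by (auto intro!: derivative_eq_intros)
  then have du: "(u has_vector_derivative \<i> * of_real (v' t)) (at t)" for t
    unfolding u[abs_def] by (auto intro!: derivative_eq_intros has_vector_derivative_of_real)
  have "(v' has_real_derivative - v t) (at t)" for t
    unfolding v_def v'_def by (auto intro!: derivative_eq_intros)
  then have du': "((\<lambda>t. \<i> * of_real (v' t)) has_vector_derivative \<i> * of_real (- v t)) (at t)" for t
    by (auto intro!: derivative_eq_intros has_vector_derivative_of_real)
  have I1: "((\<lambda>t. 1 / u t) has_integral 2 * of_real pi / Z) {0..2 * pi}"
    unfolding u_def by (rule has_integral_inverse_angular[OF \<alpha> Z])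
  have J: "((\<lambda>t. - \<alpha> * (1 / u t) + Z\<^sup>2 * (1 / u t ^ 2)) has_integral 0) {0..2 * pi}"
  proof (rule has_integral_periodic_derivative)
    fix t
    have "\<i> * of_real (- v t) * u t - \<i> * of_real (v' t) * (\<i> * of_real (v' t)) = - \<alpha> * u t + Z\<^sup>2"
      unfolding u ZQ of_real_minus using i2 tr[of t] by algebra
    then have "(\<i> * of_real (- v t) * u t - \<i> * of_real (v' t) * (\<i> * of_real (v' t))) / (u t)\<^sup>2
        = - \<alpha> * (1 / u t) + Z\<^sup>2 * (1 / u t ^ 2)"
      using u0[of t] by (simp add: power2_eq_square add_divide_distrib diff_divide_distrib)
    with has_vector_derivative_quotient[OF du' du u0, of t]
    show "((\<lambda>t. \<i> * of_real (v' t) / u t) has_vector_derivative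
        - \<alpha> * (1 / u t) + Z\<^sup>2 * (1 / u t ^ 2)) (at t)" by simp
  qed (simp add: u v_def v'_def)
  have "((\<lambda>t. ((- \<alpha> * (1 / u t) + Z\<^sup>2 * (1 / u t ^ 2)) + \<alpha> * (1 / u t)) / Z\<^sup>2) has_integral
      (0 + \<alpha> * (2 * of_real pi / Z)) / Z\<^sup>2) {0..2 * pi}"
    by (intro has_integral_divide has_integral_add J has_integral_mult_right I1)
  then show I2: ?I2
    using Z0 by (simp add: power3_eq_cube power2_eq_square mult_ac)
  have K: "((\<lambda>t. 1 / u t - 3 * \<alpha> * (1 / u t ^ 2) + 2 * Z\<^sup>2 * (1 / u t ^ 3)) has_integral 0) {0..2 * pi}"
  proof (rule has_integral_periodic_derivative)
    fix t
    have du2: "((\<lambda>t. u t ^ 2) has_vector_derivative 2 * u t * (\<i> * of_real (v' t))) (at t)"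
      using has_vector_derivative_mult[OF du du, of t] by (simp add: power2_eq_square algebra_simps)
    have "\<i> * of_real (- v t) * u t - \<i> * of_real (v' t) * (2 * (\<i> * of_real (v' t)))
        = u t ^ 2 - 3 * \<alpha> * u t + 2 * Z\<^sup>2"
      unfolding u ZQ of_real_minus using i2 tr[of t] by algebra
    then have "\<i> * of_real (- v t) * u t ^ 2 - \<i> * of_real (v' t) * (2 * u t * (\<i> * of_real (v' t)))
        = u t * (u t ^ 2 - 3 * \<alpha> * u t + 2 * Z\<^sup>2)"
      by algebra
    then have "(\<i> * of_real (- v t) * u t ^ 2 - \<i> * of_real (v' t) * (2 * u t * (\<i> * of_real (v' t)))) / (u t ^ 2)\<^sup>2
        = u t * (u t ^ 2 - 3 * \<alpha> * u t + 2 * Z\<^sup>2) / (u t ^ 2)\<^sup>2" by simp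
    also have "\<dots> = 1 / u t - 3 * \<alpha> * (1 / u t ^ 2) + 2 * Z\<^sup>2 * (1 / u t ^ 3)"
      using u0[of t] by (simp add: field_simps power2_eq_square power3_eq_cube)
    finally have "(\<i> * of_real (- v t) * u t ^ 2 - \<i> * of_real (v' t) * (2 * u t * (\<i> * of_real (v' t)))) / (u t ^ 2)\<^sup>2
        = 1 / u t - 3 * \<alpha> * (1 / u t ^ 2) + 2 * Z\<^sup>2 * (1 / u t ^ 3)" .
    with has_vector_derivative_quotient[OF du' du2] u0[of t]
    show "((\<lambda>t. \<i> * of_real (v' t) / u t ^ 2) has_vector_derivative
        1 / u t - 3 * \<alpha> * (1 / u t ^ 2) + 2 * Z\<^sup>2 * (1 / u t ^ 3)) (at t)" by simp
  qed (simp add: u v_def v'_def)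
  have "((\<lambda>t. ((1 / u t - 3 * \<alpha> * (1 / u t ^ 2) + 2 * Z\<^sup>2 * (1 / u t ^ 3)) - 1 / u t
        + 3 * \<alpha> * (1 / u t ^ 2)) / (2 * Z\<^sup>2)) has_integral
      (0 - 2 * of_real pi / Z + 3 * \<alpha> * (2 * of_real pi * \<alpha> / Z ^ 3)) / (2 * Z\<^sup>2)) {0..2 * pi}"
    by (intro has_integral_divide has_integral_add has_integral_diff K has_integral_mult_right I1 I2)
  moreover have "(0 - 2 * of_real pi / Z + 3 * \<alpha> * (2 * of_real pi * \<alpha> / Z ^ 3)) / (2 * Z\<^sup>2)
      = of_real pi * (3 * \<alpha>\<^sup>2 - Z\<^sup>2) / Z ^ 5"
    using Z0 by (simp add: field_simps eval_nat_numeral)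
  ultimately show ?I3
    using Z0 by simp
qed

text \<open>
  The numerator is quadratic in \<open>u = \<alpha> + \<i> R cos t\<close>, namely \<open>R\<^sup>2 sin\<^sup>2 t = u\<^sup>2 - 2 \<alpha> u + Z\<^sup>2\<close>, so the integral over
  a period is a combination of the three preceding ones. The integrand is symmetric about \<open>\<pi>\<close>, and half
  of the period contributes half of the value.
\<close>

lemma has_integral_sin_squared_angular:
  fixes \<alpha> Z :: complex and R :: real
  assumes \<alpha>: "Re \<alpha> > 0" and Z: "Re Z > 0" "Z\<^sup>2 = \<alpha>\<^sup>2 + of_real (R\<^sup>2)" and R: "R \<noteq> 0"
  shows "((\<lambda>t. of_real ((sin t)\<^sup>2) / (\<alpha> + \<i> * of_real (R * cos t)) ^ 3) has_integral
           of_real pi / (2 * Z ^ 3)) {0..pi}"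
proof -
  define u where "u t = \<alpha> + \<i> * of_real (R * cos t)" for t
  define g where "g t = of_real ((sin t)\<^sup>2) / u t ^ 3" for t
  have u0: "u t \<noteq> 0" for t
  proof -
    have "Re (u t) > 0" using \<alpha> by (simp add: u_def)
    then show ?thesis by force
  qed
  have Z0: "Z \<noteq> 0" using Z by auto
  have Z': "Z\<^sup>2 = \<alpha>\<^sup>2 + of_real (R\<^sup>2 + 0\<^sup>2)" using Z by simp
  have I1: "((\<lambda>t. 1 / u t) has_integral 2 * of_real pi / Z) {0..2 * pi}"
    using has_integral_inverse_angular[OF \<alpha> Z(1) Z'] by (simp add: u_def)
  have I2: "((\<lambda>t. 1 / u t ^ 2) has_integral 2 * of_real pi * \<alpha> / Z ^ 3) {0..2 * pi}"
    using has_integral_inverse_powers_angular(1)[OF \<alpha> Z(1) Z'] by (simp add: u_def)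
  have I3: "((\<lambda>t. 1 / u t ^ 3) has_integral of_real pi * (3 * \<alpha>\<^sup>2 - Z\<^sup>2) / Z ^ 5) {0..2 * pi}"
    using has_integral_inverse_powers_angular(2)[OF \<alpha> Z(1) Z'] by (simp add: u_def)
  have "((\<lambda>t. (1 / u t - (2 * \<alpha>) * (1 / u t ^ 2) + Z\<^sup>2 * (1 / u t ^ 3)) / of_real (R\<^sup>2)) has_integral
     (2 * of_real pi / Z - (2 * \<alpha>) * (2 * of_real pi * \<alpha> / Z ^ 3)
       + Z\<^sup>2 * (of_real pi * (3 * \<alpha>\<^sup>2 - Z\<^sup>2) / Z ^ 5)) / of_real (R\<^sup>2)) {0..2 * pi}"
    by (intro has_integral_divide has_integral_add has_integral_diff has_integral_mult_right I1 I2 I3)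
  moreover have "(1 / u t - (2 * \<alpha>) * (1 / u t ^ 2) + Z\<^sup>2 * (1 / u t ^ 3)) / of_real (R\<^sup>2) = g t" for t
  proof -
    have i2: "\<i> * \<i> = (-1::complex)" by simp
    have sc: "of_real (sin t) ^ 2 + of_real (cos t) ^ 2 = (1::complex)"
      by (metis of_real_1 of_real_add of_real_power sin_cos_squared_add)
    have "(u t) ^ 2 - 2 * \<alpha> * u t + Z\<^sup>2 = of_real (R\<^sup>2) * of_real ((sin t)\<^sup>2)"
      unfolding u_def Z of_real_mult of_real_power using i2 sc by algebra
    then have "of_real (R\<^sup>2) * of_real ((sin t)\<^sup>2) / u t ^ 3 = 1 / u t - (2 * \<alpha>) * (1 / u t ^ 2) + Z\<^sup>2 * (1 / u t ^ 3)"
      using u0[of t] by (simp add: field_simps power2_eq_square power3_eq_cube)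
    then show ?thesis
      using R by (simp add: g_def field_simps)
  qed
  moreover have "(2 * of_real pi / Z - (2 * \<alpha>) * (2 * of_real pi * \<alpha> / Z ^ 3)
       + Z\<^sup>2 * (of_real pi * (3 * \<alpha>\<^sup>2 - Z\<^sup>2) / Z ^ 5)) / of_real (R\<^sup>2) = of_real pi / Z ^ 3"
  proof -
    have "2 * of_real pi / Z - (2 * \<alpha>) * (2 * of_real pi * \<alpha> / Z ^ 3)
       + Z\<^sup>2 * (of_real pi * (3 * \<alpha>\<^sup>2 - Z\<^sup>2) / Z ^ 5) = of_real pi * (Z\<^sup>2 - \<alpha>\<^sup>2) / Z ^ 3"
      using Z0 by (simp add: field_simps eval_nat_numeral)
    then show ?thesis using Z(2) R by simp
  qed
  ultimately have full: "(g has_integral of_real pi / Z ^ 3) {0..2 * pi}" by simp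
  have cont: "continuous_on S g" for S
    unfolding g_def using u0 unfolding u_def by (intro continuous_intros) auto
  have half: "(g has_integral integral {0..pi} g) {0..pi}"
    by (intro integrable_integral integrable_continuous_real cont)
  \<comment> \<open>Reflection \<open>t \<mapsto> 2 \<pi> - t\<close> carries the first half of the period to the second.\<close>
  have "((\<lambda>t. g (- 1 * t + 2 * pi)) has_integral (1 / \<bar>- 1\<bar> ^ DIM(real)) *\<^sub>R integral {0..pi} g)
     ((\<lambda>t. (1 / - 1) *\<^sub>R t + - ((1 / - 1) *\<^sub>R (2 * pi))) ` cbox 0 pi)"
    using has_integral_affinity[of g "integral {0..pi} g" 0 pi "-1" "2 * pi"] half by simp
  moreover have "((\<lambda>t. (1 / - 1) *\<^sub>R t + - ((1 / - 1) *\<^sub>R (2 * pi))) ` cbox 0 pi) = {pi..2 * pi}"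
    by (auto simp: image_iff intro!: bexI[of _ "2 * pi - _"])
  moreover have "g (- 1 * t + 2 * pi) = g t" for t
    by (simp add: g_def u_def sin_diff cos_diff)
  ultimately have "(g has_integral integral {0..pi} g) {pi..2 * pi}" by simp
  from has_integral_combine[OF _ _ half this]
  have "(g has_integral integral {0..pi} g + integral {0..pi} g) {0..2 * pi}" by simp
  with full have "integral {0..pi} g + integral {0..pi} g = of_real pi / Z ^ 3"
    using has_integral_unique by blast
  then have "2 * integral {0..pi} g = 2 * (of_real pi / (2 * Z ^ 3))" by simp
  then have "integral {0..pi} g = of_real pi / (2 * Z ^ 3)" by (simp del: times_divide_eq_right)
  with half show ?thesis by (simp add: g_def[abs_def] u_def)
qed

section \<open>Surface measure of a plane in an arbitrary orthonormal frame\<close>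

lemma measurable_pair_vector:
  "(\<lambda>(x, y). vector [x, y] :: real^2) \<in> borel_measurable (lborel \<Otimes>\<^sub>M lborel)"
proof -
  have eq: "(\<lambda>(x, y). vector [x, y] :: real^2) = (\<lambda>p. fst p *\<^sub>R axis 1 1 + snd p *\<^sub>R axis 2 1)"
    by (auto simp: fun_eq_iff vec_eq_iff forall_2 axis_def)
  show ?thesis unfolding eq by measurable
qed

lemma distr_lborel_pair_vector:
  "distr (lborel \<Otimes>\<^sub>M lborel) borel (\<lambda>(x, y). vector [x, y] :: real^2) = lborel"
proof (rule lborel_eqI[symmetric])
  note m = measurable_pair_vector
  fix l u :: "real^2"
  assume le: "\<And>b. b \<in> Basis \<Longrightarrow> l \<bullet> b \<le> u \<bullet> b"
  have le': "l $ 1 \<le> u $ 1" "l $ 2 \<le> u $ 2"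
    using le[of "axis 1 1"] le[of "axis 2 1"] by (auto simp: Basis_vec_def inner_axis)
  have "(\<lambda>(x, y). vector [x, y] :: real^2) -` box l u \<inter> space (lborel \<Otimes>\<^sub>M lborel) = {l$1<..<u$1} \<times> {l$2<..<u$2}"
    by (auto simp: mem_box_cart forall_2 space_pair_measure)
  then have "emeasure (distr (lborel \<Otimes>\<^sub>M lborel) borel (\<lambda>(x, y). vector [x, y] :: real^2)) (box l u)
     = emeasure (lborel \<Otimes>\<^sub>M lborel) ({l$1<..<u$1} \<times> {l$2<..<u$2})"
    by (simp add: emeasure_distr[OF m])
  also have "\<dots> = ennreal (u$1 - l$1) * ennreal (u$2 - l$2)"
    using le' by (simp add: lborel.emeasure_pair_measure_Times)
  also have "\<dots> = ennreal (\<Prod>b\<in>Basis. (u - l) \<bullet> b)"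
  proof -
    have B: "Basis = {axis 1 1, axis 2 1 :: real^2}"
      by (auto simp: Basis_vec_def UNIV_2)
    have "axis 1 1 \<noteq> (axis 2 1 :: real^2)" by (simp add: axis_eq_axis)
    then show ?thesis using le' unfolding B by (simp add: inner_axis ennreal_mult')
  qed
  finally show "emeasure (distr (lborel \<Otimes>\<^sub>M lborel) borel (\<lambda>(x, y). vector [x, y] :: real^2)) (box l u)
     = ennreal (\<Prod>b\<in>Basis. (u - l) \<bullet> b)" .
qed simp

text \<open>
  Boxes determine Lebesgue measure, and the preimage of a box is its image under the inverse
  transformation, which preserves volume.
\<close>

lemma distr_lborel_orthogonal_transformation:
  fixes f :: "real^'n::{finite,wellorder} \<Rightarrow> real^'n::_"
  assumes f: "orthogonal_transformation f"
  shows "distr lborel borel f = lborel"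
proof (rule lborel_eqI[symmetric])
  have lin: "linear f" using f by (rule orthogonal_transformation_linear)
  then have m[measurable]: "f \<in> borel_measurable borel"
    by (intro borel_measurable_continuous_onI linear_continuous_on linear_conv_bounded_linear[THEN iffD1])
  fix l u :: "real^'n::_"
  assume le: "\<And>b. b \<in> Basis \<Longrightarrow> l \<bullet> b \<le> u \<bullet> b"
  have g: "orthogonal_transformation (inv f)" by (rule orthogonal_transformation_inv[OF f])
  have pre: "f -` box l u = inv f ` box l u"
    using orthogonal_transformation_bij[OF f] by (simp add: bij_vimage_eq_inv_image)
  have L: "box l u \<in> lmeasurable" by simp
  have open_pre: "open (f -` box l u)"
    by (intro open_vimage open_box linear_continuous_on linear_conv_bounded_linear[THEN iffD1] lin)
  have "emeasure lebesgue (inv f ` box l u) = ennreal (measure lebesgue (inv f ` box l u))"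
    using measurable_orthogonal_image[OF g L] by (simp add: emeasure_eq_measure2)
  also have "\<dots> = ennreal (measure lebesgue (box l u))"
    by (simp add: measure_orthogonal_image[OF g L])
  also have "\<dots> = emeasure lborel (box l u)"
    by (simp add: emeasure_eq_measure2)
  also have "\<dots> = ennreal (\<Prod>b\<in>Basis. (u - l) \<bullet> b)"
    using le by (simp add: emeasure_lborel_box_eq)
  finally have "emeasure lborel (f -` box l u) = ennreal (\<Prod>b\<in>Basis. (u - l) \<bullet> b)"
    using open_pre by (simp add: pre[symmetric] borel_open)
  then show "emeasure (distr lborel borel f) (box l u) = ennreal (\<Prod>b\<in>Basis. (u - l) \<bullet> b)"
    by (simp add: emeasure_distr)
qed simp

lemma chosen_frame_normal:
  assumes "normal_frame \<omega> a b"
  shows "case chosen_frame \<omega> of (a, b) \<Rightarrow> normal_frame \<omega> a b"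
  unfolding chosen_frame_def by (rule someI[of _ "(a, b)"]) (use assms in simp)

lemma normal_frame_expansion:
  assumes "norm \<omega> = 1" and F: "normal_frame \<omega> a b"
  shows "v = (v \<bullet> \<omega>) *\<^sub>R \<omega> + (v \<bullet> a) *\<^sub>R a + (v \<bullet> b) *\<^sub>R b"
proof -
  have n: "norm a = 1" "norm b = 1" and o: "\<omega> \<bullet> a = 0" "\<omega> \<bullet> b = 0" "a \<bullet> b = 0"
    using F by (auto simp: normal_frame_def orthogonal_circle_def)
  have ip: "\<omega> \<bullet> \<omega> = 1" "a \<bullet> a = 1" "b \<bullet> b = 1"
    using n assms(1) by (auto simp: norm_eq_1)
  have ne: "\<omega> \<noteq> a" "\<omega> \<noteq> b" "a \<noteq> b" using o ip by auto
  have "pairwise orthogonal {\<omega>, a, b}"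
    using o by (auto simp: pairwise_def orthogonal_def inner_commute)
  moreover have "0 \<notin> {\<omega>, a, b}" using ip by auto
  ultimately have ind: "independent {\<omega>, a, b}" by (rule pairwise_orthogonal_independent)
  have "card {\<omega>, a, b} = 3" using ne by simp
  then have "dim {\<omega>, a, b} = DIM(real^3)" using dim_eq_card_independent[OF ind] by simp
  then have sp: "span {\<omega>, a, b} = UNIV" by (simp only: dim_eq_full)
  have "(\<Sum>w\<in>{\<omega>, a, b}. (v \<bullet> w) *\<^sub>R w) = v"
    by (rule orthonormal_basis_expand)
      (use \<open>pairwise orthogonal _\<close> n assms(1) sp in auto)
  then show ?thesis using ne by (simp add: add.assoc)
qed

text \<open>
  Passing from the frame in the definition of the surface measure to another one is an orthogonal
  transformation of the coordinate plane. The freedom in the frame matters below, where the first axis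
  is taken along the direction \<open>\<xi>\<close> so that the integrand depends on one coordinate only.
\<close>

lemma plane_measure_frame:
  assumes "norm \<omega> = 1" and F: "normal_frame \<omega> a b"
  shows "plane_measure \<omega> c =
    distr (lborel \<Otimes>\<^sub>M lborel) borel (\<lambda>(x, y). c *\<^sub>R \<omega> + x *\<^sub>R a + y *\<^sub>R b)"
proof -
  obtain a0 b0 where ch: "chosen_frame \<omega> = (a0, b0)" by fastforce
  have F0: "normal_frame \<omega> a0 b0" using chosen_frame_normal[OF F] by (simp add: ch)
  have ip: "a \<bullet> a = 1" "b \<bullet> b = 1" "a \<bullet> b = 0" "b \<bullet> a = 0" "a \<bullet> \<omega> = 0" "b \<bullet> \<omega> = 0"
    using F by (auto simp: normal_frame_def orthogonal_circle_def norm_eq_1 inner_commute)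
  have ip0: "a0 \<bullet> a0 = 1" "b0 \<bullet> b0 = 1" "a0 \<bullet> b0 = 0" "b0 \<bullet> a0 = 0" "a0 \<bullet> \<omega> = 0" "b0 \<bullet> \<omega> = 0"
    using F0 by (auto simp: normal_frame_def orthogonal_circle_def norm_eq_1 inner_commute)
  have ea: "a = (a \<bullet> a0) *\<^sub>R a0 + (a \<bullet> b0) *\<^sub>R b0"
    using normal_frame_expansion[OF assms(1) F0, of a] ip by simp
  have eb: "b = (b \<bullet> a0) *\<^sub>R a0 + (b \<bullet> b0) *\<^sub>R b0"
    using normal_frame_expansion[OF assms(1) F0, of b] ip by simp
  \<comment> \<open>The change of coordinates from the frame \<open>a, b\<close> to the frame \<open>a0, b0\<close>.\<close>
  define T :: "real^2 \<Rightarrow> real^2" where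
    "T y = vector [(y$1) * (a \<bullet> a0) + (y$2) * (b \<bullet> a0), (y$1) * (a \<bullet> b0) + (y$2) * (b \<bullet> b0)]" for y
  have inner0: "(p *\<^sub>R a0 + q *\<^sub>R b0) \<bullet> (p' *\<^sub>R a0 + q' *\<^sub>R b0) = p * p' + q * q'" for p q p' q'
    using ip0 by (simp add: inner_add_left inner_add_right algebra_simps)
  have cols: "(a \<bullet> a0)\<^sup>2 + (a \<bullet> b0)\<^sup>2 = 1" "(b \<bullet> a0)\<^sup>2 + (b \<bullet> b0)\<^sup>2 = 1"
     "(a \<bullet> a0) * (b \<bullet> a0) + (a \<bullet> b0) * (b \<bullet> b0) = 0"
    using inner0[of "a \<bullet> a0" "a \<bullet> b0" "a \<bullet> a0" "a \<bullet> b0"]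
      inner0[of "b \<bullet> a0" "b \<bullet> b0" "b \<bullet> a0" "b \<bullet> b0"]
      inner0[of "a \<bullet> a0" "a \<bullet> b0" "b \<bullet> a0" "b \<bullet> b0"] ip
    by (auto simp: ea[symmetric] eb[symmetric] power2_eq_square)
  have "orthogonal_transformation T"
    unfolding orthogonal_transformation_def
  proof (intro conjI allI)
    show "linear T"
      by (rule linearI) (auto simp: T_def vec_eq_iff forall_2 algebra_simps)
    show "T v \<bullet> T w = v \<bullet> w" for v w
      using cols unfolding T_def inner_vec_def sum_2 vector_2 inner_real_def by algebra
  qed
  then have T: "distr lborel borel T = lborel" by (rule distr_lborel_orthogonal_transformation)
  have mT[measurable]: "T \<in> borel_measurable borel"
    using \<open>orthogonal_transformation T\<close>
    by (intro borel_measurable_continuous_onI linear_continuous_on linear_conv_bounded_linear[THEN iffD1]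
       orthogonal_transformation_linear)
  have mF[measurable]: "frame_map a0 b0 c \<omega> \<in> borel_measurable borel"
    unfolding frame_map_def[abs_def] by (intro borel_measurable_continuous_onI continuous_intros)
  note mV[measurable] = measurable_pair_vector
  have "plane_measure \<omega> c = distr lborel borel (frame_map a0 b0 c \<omega>)"
    by (simp add: plane_measure_def ch)
  also have "\<dots> = distr (distr (distr (lborel \<Otimes>\<^sub>M lborel) borel (\<lambda>(x, y). vector [x, y])) borel T) borel (frame_map a0 b0 c \<omega>)"
    by (simp only: distr_lborel_pair_vector T)
  also have "\<dots> = distr (lborel \<Otimes>\<^sub>M lborel) borel (frame_map a0 b0 c \<omega> \<circ> (T \<circ> (\<lambda>(x, y). vector [x, y])))"
    by (subst distr_distr, measurable, subst distr_distr) (auto simp: o_assoc)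
  also have "frame_map a0 b0 c \<omega> \<circ> (T \<circ> (\<lambda>(x, y). vector [x, y])) = (\<lambda>(x, y). c *\<^sub>R \<omega> + x *\<^sub>R a + y *\<^sub>R b)"
  proof (intro ext, clarify)
    fix x y :: real
    have "x *\<^sub>R a + y *\<^sub>R b = x *\<^sub>R ((a \<bullet> a0) *\<^sub>R a0 + (a \<bullet> b0) *\<^sub>R b0) + y *\<^sub>R ((b \<bullet> a0) *\<^sub>R a0 + (b \<bullet> b0) *\<^sub>R b0)"
      using ea eb by simp
    then show "(frame_map a0 b0 c \<omega> \<circ> (T \<circ> (\<lambda>(x, y). vector [x, y]))) (x, y) = c *\<^sub>R \<omega> + x *\<^sub>R a + y *\<^sub>R b"
      by (simp add: frame_map_def T_def algebra_simps)
  qed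
  finally show ?thesis .
qed

section \<open>The kernel integrated over an elliptic section of a cone\<close>

lemma measure_quadratic_sublevel:
  fixes a q w :: real
  assumes "a > 0"
  shows "measure lborel {y. (a * y + q)\<^sup>2 < w} = 2 * sqrt (max w 0) / a"
    and "{y. (a * y + q)\<^sup>2 < w} \<in> sets borel"
    and "emeasure lborel {y. (a * y + q)\<^sup>2 < w} < \<infinity>"
proof -
  have eq: "{y. (a * y + q)\<^sup>2 < w} = {(- sqrt (max w 0) - q) / a <..< (sqrt (max w 0) - q) / a}"
  proof (cases "w > 0")
    case True
    have "(a * y + q)\<^sup>2 < w \<longleftrightarrow> \<bar>a * y + q\<bar> < sqrt w" for y
      using True by (metis real_sqrt_abs real_sqrt_less_iff)
    moreover have "\<bar>a * y + q\<bar> < sqrt w \<longleftrightarrow> (- sqrt w - q) / a < y \<and> y < (sqrt w - q) / a" for y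
      unfolding pos_divide_less_eq[OF assms] pos_less_divide_eq[OF assms] mult.commute[of y a]
      by linarith
    ultimately have iff: "(a * y + q)\<^sup>2 < w \<longleftrightarrow> (- sqrt w - q) / a < y \<and> y < (sqrt w - q) / a" for y
      by (simp only:)
    have "max w 0 = w" using True by simp
    then show ?thesis unfolding iff by (auto simp only: set_eq_iff mem_Collect_eq greaterThanLessThan_iff)
  next
    case False
    then have "\<not> (a * y + q)\<^sup>2 < w" for y by (meson le_less_trans not_le zero_le_power2)
    with False show ?thesis by (auto simp: max_def)
  qed
  have le: "(- sqrt (max w 0) - q) / a \<le> (sqrt (max w 0) - q) / a"
    using assms by (simp add: divide_right_mono)
  show "measure lborel {y. (a * y + q)\<^sup>2 < w} = 2 * sqrt (max w 0) / a"
    unfolding eq using le by (simp add: diff_divide_distrib)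
  show "{y. (a * y + q)\<^sup>2 < w} \<in> sets borel" "emeasure lborel {y. (a * y + q)\<^sup>2 < w} < \<infinity>"
    unfolding eq using le by auto
qed

text \<open>
  Here \<open>c, n1, n2\<close> are the coordinates of the cone axis \<open>n\<close> in an orthonormal frame with first vector \<open>\<omega>\<close>,
  \<open>C\<close> and \<open>S\<close> are the cosine and sine of the half-angle, and \<open>x, y\<close> are coordinates in the plane at depth
  \<open>s\<close>. Squaring the cone inequality and completing the square first in \<open>y\<close> and then in \<open>x\<close> gives an ellipse
  whose projection to the \<open>x\<close>-axis has centre \<open>m\<close> and half-length \<open>r\<close>. Squaring adds no points: by
  Cauchy-Schwarz and \<open>c > S\<close> the opposite nappe of the cone does not meet the plane.
\<close>

lemma cone_slice_ellipse:
  fixes c n1 n2 C S s x y :: real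
  assumes n: "c\<^sup>2 + n1\<^sup>2 + n2\<^sup>2 = 1" and CS: "C\<^sup>2 + S\<^sup>2 = 1" "C > 0" "S > 0" and c: "c > S" and s: "s > 0"
  defines "a \<equiv> C\<^sup>2 - n2\<^sup>2" and "b \<equiv> c\<^sup>2 - S\<^sup>2"
  defines "m \<equiv> - s * c * n1 / b" and "r \<equiv> s * S * sqrt a / b"
  shows "a > 0" "b > 0"
    and "sqrt (s\<^sup>2 + x\<^sup>2 + y\<^sup>2) * C < s * c - n1 * x - n2 * y \<longleftrightarrow>
         (a * y + (s * c - n1 * x) * n2)\<^sup>2 < C\<^sup>2 * b * (r\<^sup>2 - (x - m)\<^sup>2)"
proof -
  have c2: "c\<^sup>2 > S\<^sup>2" using c CS by (simp add: power_strict_mono)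
  then show b: "b > 0" by (simp add: b_def)
  have ab: "a = b + n1\<^sup>2" unfolding a_def b_def using n CS by algebra
  then show a: "a > 0" using b by (simp add: add_pos_nonneg)
  define A where "A = s * c - n1 * x - n2 * y"
  have rr: "r\<^sup>2 = s\<^sup>2 * S\<^sup>2 * a / b\<^sup>2"
    using a by (simp add: r_def power_mult_distrib power_divide)
  have bm: "b * m = - s * c * n1" and br: "b\<^sup>2 * r\<^sup>2 = s\<^sup>2 * S\<^sup>2 * a"
    using b by (simp_all add: m_def rr)
  have "b * (b * (r\<^sup>2 - (x - m)\<^sup>2)) = b\<^sup>2 * r\<^sup>2 - (b * x - b * m)\<^sup>2"
    by algebra
  also have "\<dots> = b * ((s * c - n1 * x)\<^sup>2 - a * (s\<^sup>2 + x\<^sup>2))"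
  proof -
    have cc: "c\<^sup>2 = b + S\<^sup>2" by (simp add: b_def)
    show ?thesis unfolding bm br ab using cc by algebra
  qed
  finally have D: "b * (r\<^sup>2 - (x - m)\<^sup>2) = (s * c - n1 * x)\<^sup>2 - a * (s\<^sup>2 + x\<^sup>2)"
    using b by simp
  have "a * (A\<^sup>2 - C\<^sup>2 * (s\<^sup>2 + x\<^sup>2 + y\<^sup>2)) = C\<^sup>2 * (b * (r\<^sup>2 - (x - m)\<^sup>2)) - (a * y + (s * c - n1 * x) * n2)\<^sup>2"
    unfolding D A_def a_def by algebra
  then have quad: "C\<^sup>2 * (s\<^sup>2 + x\<^sup>2 + y\<^sup>2) < A\<^sup>2 \<longleftrightarrow>
      (a * y + (s * c - n1 * x) * n2)\<^sup>2 < C\<^sup>2 * b * (r\<^sup>2 - (x - m)\<^sup>2)"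
    using a by (smt (verit) mult.assoc zero_less_mult_pos mult_pos_pos)
  have "sqrt (s\<^sup>2 + x\<^sup>2 + y\<^sup>2) * C < A \<longleftrightarrow> C\<^sup>2 * (s\<^sup>2 + x\<^sup>2 + y\<^sup>2) < A\<^sup>2"
  proof
    assume "sqrt (s\<^sup>2 + x\<^sup>2 + y\<^sup>2) * C < A"
    then have "(sqrt (s\<^sup>2 + x\<^sup>2 + y\<^sup>2) * C)\<^sup>2 < A\<^sup>2"
      using CS by (intro power_strict_mono) auto
    then show "C\<^sup>2 * (s\<^sup>2 + x\<^sup>2 + y\<^sup>2) < A\<^sup>2" by (simp add: power_mult_distrib mult.commute)
  next
    assume *: "C\<^sup>2 * (s\<^sup>2 + x\<^sup>2 + y\<^sup>2) < A\<^sup>2"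
    have "(n1 * x + n2 * y)\<^sup>2 \<le> (n1\<^sup>2 + n2\<^sup>2) * (x\<^sup>2 + y\<^sup>2)"
      using zero_le_power2[of "n1 * y - n2 * x"] by (simp add: power2_eq_square algebra_simps)
    also have "\<dots> \<le> C\<^sup>2 * (s\<^sup>2 + x\<^sup>2 + y\<^sup>2)"
      using n CS c2 by (intro mult_mono) auto
    finally have "(n1 * x + n2 * y)\<^sup>2 < A\<^sup>2" using * by simp
    moreover have "s * c > 0" using s c CS by simp
    ultimately have "A > 0"
    proof (rule_tac ccontr)
      assume neg: "\<not> A > 0"
      have "(- A)\<^sup>2 \<le> (n1 * x + n2 * y)\<^sup>2"
        using neg \<open>s * c > 0\<close> unfolding A_def by (intro power_mono) auto
      with \<open>(n1 * x + n2 * y)\<^sup>2 < A\<^sup>2\<close> show False by simp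
    qed
    have "(sqrt (s\<^sup>2 + x\<^sup>2 + y\<^sup>2) * C)\<^sup>2 < A\<^sup>2"
      using * by (simp add: power_mult_distrib mult.commute)
    then show "sqrt (s\<^sup>2 + x\<^sup>2 + y\<^sup>2) * C < A"
      by (rule power2_less_imp_less[OF _ less_imp_le[OF \<open>A > 0\<close>]])
  qed
  with quad show "sqrt (s\<^sup>2 + x\<^sup>2 + y\<^sup>2) * C < s * c - n1 * x - n2 * y \<longleftrightarrow>
         (a * y + (s * c - n1 * x) * n2)\<^sup>2 < C\<^sup>2 * b * (r\<^sup>2 - (x - m)\<^sup>2)"
    by (simp add: A_def)
qed

text \<open>
  The kernel depends on \<open>x\<close> alone, so Fubini replaces the integration over \<open>y\<close> by the length of a chord of the
  ellipse, a multiple of \<open>sqrt (r\<^sup>2 - (x - m)\<^sup>2)\<close>. The substitution \<open>x = m - r cos t\<close> leads to an angular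
  integral whose quantity \<open>Z\<^sup>2 = (s - \<i> m)\<^sup>2 + r\<^sup>2\<close> is the perfect square of \<open>s (c + \<i> n1) / sqrt b\<close>. This is why
  the result is an inverse cube of a linear expression in \<open>n\<close>, with no root left.
\<close>

lemma integral_inverse_cube_ellipse:
  fixes c n1 n2 C S s :: real
  assumes n: "c\<^sup>2 + n1\<^sup>2 + n2\<^sup>2 = 1" and CS: "C\<^sup>2 + S\<^sup>2 = 1" "C > 0" "S > 0" and c: "c > S" and s: "s > 0"
  shows "(LINT p|(lborel \<Otimes>\<^sub>M lborel).
            indicator {(x, y). sqrt (s\<^sup>2 + x\<^sup>2 + y\<^sup>2) * C < s * c - n1 * x - n2 * y} p
              *\<^sub>R (1 / (of_real s - \<i> * of_real (fst p)) ^ 3))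
         = of_real (pi * C * S\<^sup>2) / (of_real s * (of_real c + \<i> * of_real n1) ^ 3)"
    (is "(LINT p|_. indicator ?E p *\<^sub>R ?k p) = _")
proof -
  define a where "a = C\<^sup>2 - n2\<^sup>2"
  define b where "b = c\<^sup>2 - S\<^sup>2"
  define m where "m = - s * c * n1 / b"
  define r where "r = s * S * sqrt a / b"
  note [folded a_def b_def, folded m_def r_def] = cone_slice_ellipse[OF n CS c s]
  note a = this(1) and b = this(2) and E = this(3)
  have r: "r > 0" using s CS a b by (simp add: r_def)
  have sx: "of_real s - \<i> * of_real x \<noteq> (0::complex)" for x
    using s by (auto simp: complex_eq_iff)
  define k where "k x = 1 / (of_real s - \<i> * of_real x :: complex) ^ 3" for x
  have contk: "continuous_on T k" for T
    unfolding k_def using sx by (intro continuous_intros) auto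
  then have mk[measurable]: "k \<in> borel_measurable borel"
    by (rule borel_measurable_continuous_onI)
  have Em: "?E \<in> sets (lborel \<Otimes>\<^sub>M lborel)"
  proof -
    have "?E = {p \<in> space (lborel \<Otimes>\<^sub>M lborel). sqrt (s\<^sup>2 + (fst p)\<^sup>2 + (snd p)\<^sup>2) * C < s * c - n1 * fst p - n2 * snd p}"
      by (auto simp: space_pair_measure)
    also have "\<dots> \<in> sets (lborel \<Otimes>\<^sub>M lborel)" by measurable
    finally show ?thesis .
  qed
  \<comment> \<open>On the ellipse \<open>(C - q) \<bar>(x, y)\<bar> < s c\<close>, which makes the region bounded and the integrand integrable.\<close>
  define q where "q = sqrt (n1\<^sup>2 + n2\<^sup>2)"
  define M where "M = s * c / (C - q)"
  have q: "q < C"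
  proof -
    have "c\<^sup>2 > S\<^sup>2" using c CS by (simp add: power_strict_mono)
    then have "n1\<^sup>2 + n2\<^sup>2 < C\<^sup>2" using n CS by linarith
    then show ?thesis unfolding q_def using CS by (intro real_less_lsqrt) auto
  qed
  have bdd: "?E \<subseteq> {-M..M} \<times> {-M..M}"
  proof (clarify)
    fix x y assume *: "sqrt (s\<^sup>2 + x\<^sup>2 + y\<^sup>2) * C < s * c - n1 * x - n2 * y"
    have "\<bar>n1 * x + n2 * y\<bar> \<le> q * sqrt (x\<^sup>2 + y\<^sup>2)"
      unfolding q_def real_sqrt_mult[symmetric]
      by (rule real_le_rsqrt) (use zero_le_power2[of "n1 * y - n2 * x"] in \<open>simp add: power2_eq_square algebra_simps\<close>)
    moreover have "sqrt (x\<^sup>2 + y\<^sup>2) * C \<le> sqrt (s\<^sup>2 + x\<^sup>2 + y\<^sup>2) * C"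
      using CS by (intro mult_right_mono) auto
    ultimately have "sqrt (x\<^sup>2 + y\<^sup>2) * (C - q) < s * c"
      using * by (simp add: algebra_simps)
    then have "sqrt (x\<^sup>2 + y\<^sup>2) < M" using q by (simp add: M_def pos_less_divide_eq)
    then have "\<bar>x\<bar> < M" "\<bar>y\<bar> < M"
      using real_sqrt_ge_abs1[of x y] real_sqrt_ge_abs2[of y x] by linarith+
    then show "x \<in> {-M..M} \<and> y \<in> {-M..M}" by auto
  qed
  have "integrable (lborel \<Otimes>\<^sub>M lborel) (\<lambda>p. indicator ?E p *\<^sub>R k (fst p))"
  proof (rule integrableI_bounded_set)
    show "{-M..M} \<times> {-M..M} \<in> sets (lborel \<Otimes>\<^sub>M lborel :: (real \<times> real) measure)" by auto
    show "(\<lambda>p. indicator ?E p *\<^sub>R k (fst p)) \<in> borel_measurable (lborel \<Otimes>\<^sub>M lborel)"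
      using Em by measurable
    show "emeasure (lborel \<Otimes>\<^sub>M lborel) ({-M..M} \<times> {-M..M} :: (real \<times> real) set) < \<infinity>"
      by (simp add: lborel.emeasure_pair_measure_Times emeasure_lborel_Icc_eq ennreal_mult_less_top)
    show "AE p\<in>{-M..M} \<times> {-M..M} in lborel \<Otimes>\<^sub>M lborel. norm (indicator ?E p *\<^sub>R k (fst p)) \<le> 1 / s ^ 3"
    proof (rule AE_I2, rule impI)
      fix p :: "real \<times> real"
      have "s \<le> norm (of_real s - \<i> * of_real (fst p) :: complex)"
        using complex_Re_le_cmod[of "of_real s - \<i> * of_real (fst p)"] by simp
      then have "s ^ 3 \<le> norm (of_real s - \<i> * of_real (fst p) :: complex) ^ 3"
        using s by (intro power_mono) auto
      then have "norm (k (fst p)) \<le> 1 / s ^ 3"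
        using s by (simp add: k_def norm_divide norm_power frac_le)
      moreover have "0 \<le> 1 / s ^ 3" using s by simp
      ultimately show "norm (indicator ?E p *\<^sub>R k (fst p)) \<le> 1 / s ^ 3"
        by (simp add: indicator_def)
    qed
    show "AE p in lborel \<Otimes>\<^sub>M lborel. p \<notin> {-M..M} \<times> {-M..M} \<longrightarrow> indicator ?E p *\<^sub>R k (fst p) = 0"
      using bdd by (intro AE_I2) (auto simp: indicator_def)
  qed
  from lborel_pair.integral_fst'[OF this]
  have "(LINT p|(lborel \<Otimes>\<^sub>M lborel). indicator ?E p *\<^sub>R ?k p)
     = (LINT x|lborel. (LINT y|lborel. indicator ?E (x, y) *\<^sub>R k x))"
    by (simp add: k_def)
  also have "\<dots> = (LINT x|lborel. (2 * sqrt (max (C\<^sup>2 * b * (r\<^sup>2 - (x - m)\<^sup>2)) 0) / a) *\<^sub>R k x)"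
  proof (rule Bochner_Integration.integral_cong[OF refl])
    fix x :: real
    let ?Y = "{y. (a * y + (s * c - n1 * x) * n2)\<^sup>2 < C\<^sup>2 * b * (r\<^sup>2 - (x - m)\<^sup>2)}"
    have "(LINT y|lborel. indicator ?E (x, y) *\<^sub>R k x) = (LINT y|lborel. indicator ?Y y *\<^sub>R k x)"
      using E by (intro Bochner_Integration.integral_cong) (auto simp: indicator_def)
    also have "\<dots> = measure lborel ?Y *\<^sub>R k x"
      using measure_quadratic_sublevel(2,3)[OF a] by (subst integral_scaleR_left) auto
    finally show "(LINT y|lborel. indicator ?E (x, y) *\<^sub>R k x)
        = (2 * sqrt (max (C\<^sup>2 * b * (r\<^sup>2 - (x - m)\<^sup>2)) 0) / a) *\<^sub>R k x"
      by (simp only: measure_quadratic_sublevel(1)[OF a])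
  qed
  also have "\<dots> = (LINT x:{m - r..m + r}|lborel. (2 * C * sqrt b / a * sqrt (r\<^sup>2 - (x - m)\<^sup>2)) *\<^sub>R k x)"
    unfolding set_lebesgue_integral_def
  proof (rule Bochner_Integration.integral_cong[OF refl])
    fix x :: real
    have "\<bar>x - m\<bar> \<le> r \<longleftrightarrow> (x - m)\<^sup>2 \<le> r\<^sup>2" using r by (simp add: abs_le_square_iff[symmetric])
    then have iff: "x \<in> {m - r..m + r} \<longleftrightarrow> 0 \<le> r\<^sup>2 - (x - m)\<^sup>2" by auto
    show "(2 * sqrt (max (C\<^sup>2 * b * (r\<^sup>2 - (x - m)\<^sup>2)) 0) / a) *\<^sub>R k x
      = indicat_real {m - r..m + r} x *\<^sub>R ((2 * C * sqrt b / a * sqrt (r\<^sup>2 - (x - m)\<^sup>2)) *\<^sub>R k x)"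
    proof (cases "0 \<le> r\<^sup>2 - (x - m)\<^sup>2")
      case True
      then have "max (C\<^sup>2 * b * (r\<^sup>2 - (x - m)\<^sup>2)) 0 = C\<^sup>2 * b * (r\<^sup>2 - (x - m)\<^sup>2)"
        using b by (intro max_absorb1 mult_nonneg_nonneg) auto
      with True iff show ?thesis using CS by (simp add: real_sqrt_mult)
    next
      case False
      then have "C\<^sup>2 * b * (r\<^sup>2 - (x - m)\<^sup>2) \<le> 0"
        using b by (intro mult_nonneg_nonpos) auto
      with False iff show ?thesis by simp
    qed
  qed
  also have "\<dots> = integral {m - r..m + r} (\<lambda>x. (2 * C * sqrt b / a * sqrt (r\<^sup>2 - (x - m)\<^sup>2)) *\<^sub>R k x)"
  proof (rule set_borel_integral_eq_integral(2))
    show "set_integrable lborel {m - r..m + r} (\<lambda>x. (2 * C * sqrt b / a * sqrt (r\<^sup>2 - (x - m)\<^sup>2)) *\<^sub>R k x)"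
      unfolding set_integrable_def
      by (intro borel_integrable_compact continuous_intros contk) (use a in auto)
  qed
  also have "\<dots> = of_real (pi * C * S\<^sup>2) / (of_real s * (of_real c + \<i> * of_real n1) ^ 3)"
  proof -
    define h where "h x = (2 * C * sqrt b / a * sqrt (r\<^sup>2 - (x - m)\<^sup>2)) *\<^sub>R k x" for x
    define \<alpha> :: complex where "\<alpha> = of_real s - \<i> * of_real m"
    define W :: complex where "W = of_real c + \<i> * of_real n1"
    define Z :: complex where "Z = of_real (s / sqrt b) * W"
    have subst: "((\<lambda>t. (r * sin t) *\<^sub>R h (m - r * cos t)) has_integral integral {m - r * cos 0..m - r * cos pi} h) {0..pi}"
    proof (rule has_integral_substitution[where c = "m - r" and d = "m + r"])
      show "(\<lambda>t. m - r * cos t) ` {0..pi} \<subseteq> {m - r..m + r}"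
      proof (rule image_subsetI)
        fix t
        have "r * cos t \<le> r * 1" "r * (- 1) \<le> r * cos t"
          using r by (intro mult_left_mono; simp)+
        then show "m - r * cos t \<in> {m - r..m + r}" by simp
      qed
      show "m - r * cos 0 \<le> m - r * cos pi" "0 \<le> pi" using r by simp_all
      show "((\<lambda>t. m - r * cos t) has_real_derivative r * sin t) (at t within {0..pi})" for t
        by (auto intro!: derivative_eq_intros)
      show "continuous_on {m - r..m + r} h"
        unfolding h_def using a by (intro continuous_intros contk) auto
    qed
    have eq: "(r * sin t) *\<^sub>R h (m - r * cos t) =
       of_real (2 * C * sqrt b * r\<^sup>2 / a) * (of_real ((sin t)\<^sup>2) / (\<alpha> + \<i> * of_real (r * cos t)) ^ 3)"
      if "t \<in> {0..pi}" for t
    proof -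
      have "r\<^sup>2 - (m - r * cos t - m)\<^sup>2 = (r * sin t)\<^sup>2"
        using sin_cos_squared_add[of t] by algebra
      then have "sqrt (r\<^sup>2 - (m - r * cos t - m)\<^sup>2) = r * sin t"
        using r that by (simp add: sin_ge_zero abs_mult)
      moreover have "k (m - r * cos t) = 1 / (\<alpha> + \<i> * of_real (r * cos t)) ^ 3"
        by (simp add: k_def \<alpha>_def algebra_simps)
      ultimately show ?thesis
        by (simp add: h_def scaleR_conv_of_real power2_eq_square)
    qed
    have 1: "((\<lambda>t. of_real (2 * C * sqrt b * r\<^sup>2 / a) *
        (of_real ((sin t)\<^sup>2) / (\<alpha> + \<i> * of_real (r * cos t)) ^ 3)) has_integral integral {m - r..m + r} h) {0..pi}"
      using subst by (subst has_integral_cong[OF eq[symmetric]]) simp_all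
    \<comment> \<open>The identity behind the closed form, compared in real and imaginary parts after clearing \<open>b\<close>.\<close>
    have "Z\<^sup>2 = \<alpha>\<^sup>2 + of_real (r\<^sup>2)"
    proof -
      have 1: "b * m = - s * c * n1" and 2: "b\<^sup>2 * r\<^sup>2 = s\<^sup>2 * S\<^sup>2 * a" and 3: "b * (s / sqrt b)\<^sup>2 = s\<^sup>2"
        using a b by (simp_all add: m_def r_def power_mult_distrib power_divide power2_eq_square)
      have cc: "c\<^sup>2 = b + S\<^sup>2" by (simp add: b_def)
      have aa: "a = b + n1\<^sup>2" unfolding a_def b_def using n CS by algebra
      have "b\<^sup>2 * (t2 * (c\<^sup>2 - n1\<^sup>2)) = b\<^sup>2 * (s\<^sup>2 - m\<^sup>2 + r\<^sup>2)" if "b * t2 = s\<^sup>2" for t2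
      proof -
        have "b\<^sup>2 * (t2 * (c\<^sup>2 - n1\<^sup>2)) = b * (b * t2) * (c\<^sup>2 - n1\<^sup>2)" by algebra
        also have "\<dots> = b\<^sup>2 * s\<^sup>2 - (- s * c * n1)\<^sup>2 + s\<^sup>2 * S\<^sup>2 * a"
          unfolding that aa using cc by algebra
        also have "\<dots> = b\<^sup>2 * (s\<^sup>2 - m\<^sup>2 + r\<^sup>2)"
          unfolding 1[symmetric] 2[symmetric] by algebra
        finally show ?thesis .
      qed
      from this[OF 3] have re: "b\<^sup>2 * ((s / sqrt b)\<^sup>2 * (c\<^sup>2 - n1\<^sup>2)) = b\<^sup>2 * (s\<^sup>2 - m\<^sup>2 + r\<^sup>2)" .
      have "b * (t2 * (2 * c * n1)) = b * (- 2 * s * m)" if "b * t2 = s\<^sup>2" for t2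
        using 1 that by algebra
      from this[OF 3] have im: "b * ((s / sqrt b)\<^sup>2 * (2 * c * n1)) = b * (- 2 * s * m)" .
      have e1: "(s / sqrt b)\<^sup>2 * (c\<^sup>2 - n1\<^sup>2) = s\<^sup>2 - m\<^sup>2 + r\<^sup>2"
        using re b by (subst (asm) mult_cancel_left) simp
      have e2: "(s / sqrt b)\<^sup>2 * (2 * c * n1) = - 2 * s * m"
        using im b by (subst (asm) mult_cancel_left) simp
      have W: "Re ((of_real t * W)\<^sup>2) = t\<^sup>2 * (c\<^sup>2 - n1\<^sup>2)" "Im ((of_real t * W)\<^sup>2) = t\<^sup>2 * (2 * c * n1)" for t
        unfolding W_def by (simp_all add: power2_eq_square algebra_simps)
      have \<alpha>': "Re (\<alpha>\<^sup>2 + of_real (r\<^sup>2)) = s\<^sup>2 - m\<^sup>2 + r\<^sup>2" "Im (\<alpha>\<^sup>2 + of_real (r\<^sup>2)) = - 2 * s * m"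
        unfolding \<alpha>_def by (simp_all add: power2_eq_square algebra_simps)
      show ?thesis unfolding Z_def complex_eq_iff W \<alpha>' e1 e2 by blast
    qed
    moreover have "Re Z > 0" using s b c CS by (simp add: Z_def W_def)
    moreover have "Re \<alpha> > 0" using s by (simp add: \<alpha>_def)
    ultimately have "((\<lambda>t. of_real ((sin t)\<^sup>2) / (\<alpha> + \<i> * of_real (r * cos t)) ^ 3) has_integral
           of_real pi / (2 * Z ^ 3)) {0..pi}"
      using has_integral_sin_squared_angular r by blast
    from has_integral_mult_right[OF this, of "of_real (2 * C * sqrt b * r\<^sup>2 / a)"]
    have "integral {m - r..m + r} h = of_real (2 * C * sqrt b * r\<^sup>2 / a) * (of_real pi / (2 * Z ^ 3))"
      using 1 by (rule has_integral_unique[rotated])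
    also have "\<dots> = of_real (2 * C * sqrt b * r\<^sup>2 / a * pi / (2 * (s / sqrt b) ^ 3)) / W ^ 3"
      unfolding Z_def power_mult_distrib by simp
    also have "2 * C * sqrt b * r\<^sup>2 / a * pi / (2 * (s / sqrt b) ^ 3) = pi * C * S\<^sup>2 / s"
    proof -
      have "2 * C * q * ((s * S)\<^sup>2 * a / (q\<^sup>2)\<^sup>2) / a * pi / (2 * (s / q) ^ 3) = pi * C * S\<^sup>2 / s"
        if "q > 0" for q
        using that s a by (simp add: field_simps power2_eq_square power3_eq_cube)
      from this[of "sqrt b"] show ?thesis
        using a b by (simp add: r_def power_divide power_mult_distrib)
    qed
    finally show ?thesis unfolding h_def[abs_def] W_def using s by simp
  qed
  finally show ?thesis .
qed

section \<open>Cross-sections of a circular cone\<close>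

lemma circular_cone_scale:
  assumes "r > 0"
  shows "p + r *\<^sub>R v \<in> circular_cone p w \<theta> \<longleftrightarrow> p + v \<in> circular_cone p w \<theta>"
proof -
  have "r * (v \<bullet> w) > r * (norm v * cos \<theta>) \<longleftrightarrow> v \<bullet> w > norm v * cos \<theta>"
    using assms by (simp only: mult_less_cancel_left_pos)
  then show ?thesis using assms by (simp add: circular_cone_def mult.assoc)
qed

text \<open>
  A cone is invariant under homotheties centred at its vertex, so any of its slices generates the part
  of it in the slab above that slice.
\<close>

lemma conical_region_cone_slice:
  assumes "\<delta> > 0"
  shows "conical_region p \<delta> (cone_slice p n \<theta> \<omega> \<delta>) =
    circular_cone p (- n) \<theta> \<inter> {x. p \<bullet> \<omega> - \<delta> < x \<bullet> \<omega> \<and> x \<bullet> \<omega> < p \<bullet> \<omega>}"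
proof (intro set_eqI iffI)
  fix x assume "x \<in> conical_region p \<delta> (cone_slice p n \<theta> \<omega> \<delta>)"
  then obtain s z where s: "0 < s" "s < \<delta>" and z: "z \<in> circular_cone p (- n) \<theta>" "z \<bullet> \<omega> = p \<bullet> \<omega> - \<delta>"
    and x: "x = p + (s / \<delta>) *\<^sub>R (z - p)"
    by (auto simp: conical_region_def cone_slice_def plane_at_depth_def)
  have "x \<in> circular_cone p (- n) \<theta>"
    unfolding x using circular_cone_scale[of "s / \<delta>" p "z - p"] s z assms by simp
  moreover have "x \<bullet> \<omega> = p \<bullet> \<omega> - s"
    unfolding x using assms z(2) by (simp add: inner_add_left inner_diff_left)
  ultimately show "x \<in> circular_cone p (- n) \<theta> \<inter> {x. p \<bullet> \<omega> - \<delta> < x \<bullet> \<omega> \<and> x \<bullet> \<omega> < p \<bullet> \<omega>}"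
    using s by simp
next
  fix x assume x: "x \<in> circular_cone p (- n) \<theta> \<inter> {x. p \<bullet> \<omega> - \<delta> < x \<bullet> \<omega> \<and> x \<bullet> \<omega> < p \<bullet> \<omega>}"
  define s where "s = p \<bullet> \<omega> - x \<bullet> \<omega>"
  define z where "z = p + (\<delta> / s) *\<^sub>R (x - p)"
  have s: "0 < s" "s < \<delta>" using x by (auto simp: s_def)
  have "z \<in> circular_cone p (- n) \<theta>"
    unfolding z_def using circular_cone_scale[of "\<delta> / s" p "x - p"] s x assms by simp
  moreover have "(x - p) \<bullet> \<omega> = - s" by (simp add: s_def inner_diff_left)
  then have "z \<bullet> \<omega> = p \<bullet> \<omega> - \<delta>"
    unfolding z_def using s by (simp add: inner_add_left)
  ultimately have "z \<in> cone_slice p n \<theta> \<omega> \<delta>" by (simp add: cone_slice_def plane_at_depth_def)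
  moreover have "x = p + (s / \<delta>) *\<^sub>R (z - p)" using s by (simp add: z_def)
  ultimately show "x \<in> conical_region p \<delta> (cone_slice p n \<theta> \<omega> \<delta>)"
    using s unfolding conical_region_def by (auto intro!: bexI[of _ s])
qed

lemma conical_region_Int_plane:
  assumes "0 < s" "s < \<delta>"
  shows "conical_region p \<delta> (cone_slice p n \<theta> \<omega> \<delta>) \<inter> plane_at_depth p \<omega> s = cone_slice p n \<theta> \<omega> s"
  using assms by (subst conical_region_cone_slice) (auto simp: cone_slice_def plane_at_depth_def)

text \<open>
  The defining coordinates have their origin at the point of the plane closest to \<open>0\<close>. Translation
  invariance moves it to the orthogonal projection of \<open>p\<close>, the natural origin for a cone with vertex \<open>p\<close>.
\<close>

lemma plane_measure_at_depth:
  assumes "norm \<omega> = 1" and F: "normal_frame \<omega> a b"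
  shows "plane_measure \<omega> (p \<bullet> \<omega> - s) =
    distr (lborel \<Otimes>\<^sub>M lborel) borel (\<lambda>(x, y). p + (- s *\<^sub>R \<omega> + x *\<^sub>R a + y *\<^sub>R b))"
proof -
  define G where "G = (\<lambda>(x, y). (p \<bullet> \<omega> - s) *\<^sub>R \<omega> + x *\<^sub>R a + y *\<^sub>R b)"
  have "continuous_on UNIV G" unfolding G_def case_prod_unfold by (intro continuous_intros)
  then have mG[measurable]: "G \<in> borel_measurable borel" by (rule borel_measurable_continuous_onI)
  let ?t = "(p \<bullet> a, p \<bullet> b)"
  have "plane_measure \<omega> (p \<bullet> \<omega> - s) = distr lborel borel G"
    unfolding plane_measure_frame[OF assms] G_def lborel_prod ..
  also have "\<dots> = distr (distr lborel borel ((+) ?t)) borel G"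
    by (simp only: lborel_distr_plus)
  also have "\<dots> = distr lborel borel (G \<circ> (+) ?t)"
    by (rule distr_distr) simp_all
  also have "G \<circ> (+) ?t = (\<lambda>(x, y). p + (- s *\<^sub>R \<omega> + x *\<^sub>R a + y *\<^sub>R b))"
  proof (intro ext, clarify)
    fix x y
    have "(G \<circ> (+) ?t) (x, y) = ((p \<bullet> \<omega>) *\<^sub>R \<omega> + (p \<bullet> a) *\<^sub>R a + (p \<bullet> b) *\<^sub>R b) + (- s *\<^sub>R \<omega> + x *\<^sub>R a + y *\<^sub>R b)"
      by (simp add: G_def algebra_simps)
    then show "(G \<circ> (+) ?t) (x, y) = p + (- s *\<^sub>R \<omega> + x *\<^sub>R a + y *\<^sub>R b)"
      by (simp only: normal_frame_expansion[OF assms, of p, symmetric])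
  qed
  finally show ?thesis unfolding lborel_prod .
qed

lemma normal_frame_cross3:
  assumes "norm \<omega> = 1" and "\<xi> \<in> orthogonal_circle \<omega>"
  shows "normal_frame \<omega> \<xi> (cross3 \<omega> \<xi>)"
proof -
  have "(norm (cross3 \<omega> \<xi>))\<^sup>2 = 1"
    using assms unfolding norm_cross by (simp add: orthogonal_circle_def)
  then have "norm (cross3 \<omega> \<xi>) = 1" by (simp add: power2_eq_1_iff) (smt (verit) norm_ge_zero)
  then show ?thesis
    using assms by (simp add: normal_frame_def orthogonal_circle_def dot_cross_self)
qed

text \<open>
  With \<open>\<xi>\<close> as first axis of the plane the cross-section is the ellipse above, and the factor \<open>2 s\<close> cancels
  the remaining dependence on the depth.
\<close>

lemma cross_section_integral_cone:
  assumes \<omega>: "norm \<omega> = 1" and n: "norm n = 1" and \<theta>: "0 < \<theta>" "\<theta> < pi / 2"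
    and c: "n \<bullet> \<omega> > sin \<theta>" and \<xi>: "\<xi> \<in> orthogonal_circle \<omega>" and s: "0 < s" "s < \<delta>"
  shows "cross_section_integral p \<omega> \<delta> (cone_slice p n \<theta> \<omega> \<delta>) \<xi> s =
    of_real (6 * cone_volume \<theta>) / (of_real (n \<bullet> \<omega>) + \<i> * of_real (n \<bullet> \<xi>)) ^ 3"
proof -
  define \<eta> where "\<eta> = cross3 \<omega> \<xi>"
  have F: "normal_frame \<omega> \<xi> \<eta>" unfolding \<eta>_def by (rule normal_frame_cross3[OF \<omega> \<xi>])
  have ip: "\<xi> \<bullet> \<xi> = 1" "\<eta> \<bullet> \<eta> = 1" "\<omega> \<bullet> \<omega> = 1" "\<xi> \<bullet> \<eta> = 0" "\<eta> \<bullet> \<xi> = 0" "\<xi> \<bullet> \<omega> = 0" "\<eta> \<bullet> \<omega> = 0" "\<omega> \<bullet> \<xi> = 0" "\<omega> \<bullet> \<eta> = 0"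
    using F \<omega> by (auto simp: normal_frame_def orthogonal_circle_def norm_eq_1 inner_commute)
  have nn: "(n \<bullet> \<omega>)\<^sup>2 + (n \<bullet> \<xi>)\<^sup>2 + (n \<bullet> \<eta>)\<^sup>2 = 1"
  proof -
    have "n \<bullet> n = n \<bullet> ((n \<bullet> \<omega>) *\<^sub>R \<omega> + (n \<bullet> \<xi>) *\<^sub>R \<xi> + (n \<bullet> \<eta>) *\<^sub>R \<eta>)"
      using normal_frame_expansion[OF \<omega> F, of n] by simp
    then show ?thesis using n by (simp add: norm_eq_1 inner_add_right power2_eq_square)
  qed
  define G where "G = (\<lambda>(x, y). p + (- s *\<^sub>R \<omega> + x *\<^sub>R \<xi> + y *\<^sub>R \<eta>))"
  have "continuous_on UNIV G" unfolding G_def case_prod_unfold by (intro continuous_intros)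
  then have mG: "G \<in> borel_measurable (lborel \<Otimes>\<^sub>M lborel)"
    unfolding lborel_prod by (simp add: borel_measurable_continuous_onI)
  define f where "f z = 1 / (of_real s - \<i> * of_real ((z - p) \<bullet> \<xi>)) ^ 3" for z
  have "of_real s - \<i> * of_real x \<noteq> (0::complex)" for x
    using s by (auto simp: complex_eq_iff)
  then have "continuous_on UNIV f" unfolding f_def by (intro continuous_intros) auto
  then have mf: "f \<in> borel_measurable borel" by (rule borel_measurable_continuous_onI)
  have slice: "cone_slice p n \<theta> \<omega> s \<in> sets borel"
  proof -
    have "open (circular_cone p (- n) \<theta>)"
      unfolding circular_cone_def by (intro open_Collect_less continuous_intros)
    moreover have "closed (plane_at_depth p \<omega> s)"
      unfolding plane_at_depth_def by (intro closed_Collect_eq continuous_intros)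
    ultimately show ?thesis unfolding cone_slice_def by (intro sets.Int) auto
  qed
  have mem: "G (x, y) \<in> cone_slice p n \<theta> \<omega> s \<longleftrightarrow>
      sqrt (s\<^sup>2 + x\<^sup>2 + y\<^sup>2) * cos \<theta> < s * (n \<bullet> \<omega>) - (n \<bullet> \<xi>) * x - (n \<bullet> \<eta>) * y" for x y
  proof -
    have "norm (- s *\<^sub>R \<omega> + x *\<^sub>R \<xi> + y *\<^sub>R \<eta>) = sqrt (s\<^sup>2 + x\<^sup>2 + y\<^sup>2)"
      unfolding norm_eq_sqrt_inner
      by (simp add: inner_add_left inner_add_right inner_diff_left inner_diff_right ip power2_eq_square)
    moreover have "(- s *\<^sub>R \<omega> + x *\<^sub>R \<xi> + y *\<^sub>R \<eta>) \<bullet> (- n) = s * (n \<bullet> \<omega>) - (n \<bullet> \<xi>) * x - (n \<bullet> \<eta>) * y"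
      by (simp add: inner_add_left inner_diff_left inner_add_right inner_diff_right inner_commute[of _ n] mult.commute)
    moreover have "G (x, y) \<bullet> \<omega> = p \<bullet> \<omega> - s"
      by (simp add: G_def inner_add_left inner_diff_left ip)
    ultimately show ?thesis
      by (simp add: cone_slice_def plane_at_depth_def circular_cone_def G_def)
  qed
  let ?E = "{(x, y). sqrt (s\<^sup>2 + x\<^sup>2 + y\<^sup>2) * cos \<theta> < s * (n \<bullet> \<omega>) - (n \<bullet> \<xi>) * x - (n \<bullet> \<eta>) * y}"
  have "(LINT z:cone_slice p n \<theta> \<omega> s|plane_measure \<omega> (p \<bullet> \<omega> - s). f z)
      = (LINT q|(lborel \<Otimes>\<^sub>M lborel). indicat_real (cone_slice p n \<theta> \<omega> s) (G q) *\<^sub>R f (G q))"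
    unfolding set_lebesgue_integral_def plane_measure_at_depth[OF \<omega> F] G_def[symmetric]
    by (rule integral_distr[OF mG]) (use mf slice in measurable)
  also have "\<dots> = (LINT q|(lborel \<Otimes>\<^sub>M lborel). indicator ?E q *\<^sub>R (1 / (of_real s - \<i> * of_real (fst q)) ^ 3))"
  proof (rule Bochner_Integration.integral_cong[OF refl])
    fix q :: "real \<times> real"
    obtain x y where q: "q = (x, y)" by fastforce
    have "(G q - p) \<bullet> \<xi> = x" by (simp add: q G_def inner_add_left inner_diff_left ip)
    moreover have "indicat_real (cone_slice p n \<theta> \<omega> s) (G q) = indicator ?E q"
      using mem[of x y] by (simp add: q indicator_def)
    ultimately show "indicat_real (cone_slice p n \<theta> \<omega> s) (G q) *\<^sub>R f (G q)
        = indicator ?E q *\<^sub>R (1 / (of_real s - \<i> * of_real (fst q)) ^ 3)"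
      by (simp add: f_def q)
  qed
  also have "\<dots> = of_real (pi * cos \<theta> * (sin \<theta>)\<^sup>2) / (of_real s * (of_real (n \<bullet> \<omega>) + \<i> * of_real (n \<bullet> \<xi>)) ^ 3)"
    by (rule integral_inverse_cube_ellipse[OF nn _ _ _ c s(1)])
      (use \<theta> in \<open>auto intro!: cos_gt_zero sin_gt_zero\<close>)
  finally show ?thesis
    unfolding cross_section_integral_def conical_region_Int_plane[OF s] f_def
    using s by (simp add: cone_volume_def)
qed

lemma C_coeff_cone:
  assumes "norm \<omega> = 1" "norm n = 1" "0 < \<theta>" "\<theta> < pi / 2"
    and "n \<bullet> \<omega> > sin \<theta>" "\<xi> \<in> orthogonal_circle \<omega>" "\<delta> > 0"
  shows "C_coeff p \<omega> \<delta> (cone_slice p n \<theta> \<omega> \<delta>) \<xi> =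
    of_real (6 * cone_volume \<theta>) / (of_real (n \<bullet> \<omega>) + \<i> * of_real (n \<bullet> \<xi>)) ^ 3"
  unfolding C_coeff_def
proof (rule the_equality)
  show "\<forall>s\<in>{0<..<\<delta>}. cross_section_integral p \<omega> \<delta> (cone_slice p n \<theta> \<omega> \<delta>) \<xi> s =
      of_real (6 * cone_volume \<theta>) / (of_real (n \<bullet> \<omega>) + \<i> * of_real (n \<bullet> \<xi>)) ^ 3"
    using cross_section_integral_cone[OF assms(1-6)] by auto
  fix c assume "\<forall>s\<in>{0<..<\<delta>}. cross_section_integral p \<omega> \<delta> (cone_slice p n \<theta> \<omega> \<delta>) \<xi> s = c"
  then have "cross_section_integral p \<omega> \<delta> (cone_slice p n \<theta> \<omega> \<delta>) \<xi> (\<delta> / 2) = c"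
    using assms(7) by auto
  then show "c = of_real (6 * cone_volume \<theta>) / (of_real (n \<bullet> \<omega>) + \<i> * of_real (n \<bullet> \<xi>)) ^ 3"
    using cross_section_integral_cone[OF assms(1-6), of "\<delta> / 2" \<delta>] assms(7) by simp
qed

section \<open>The cone at the contact point\<close>

lemma contact_point_strict_max:
  assumes "bounded D" "D \<noteq> {}" "regular_direction D \<omega>"
  defines "p \<equiv> contact_point D \<omega>"
  shows "support_fun D \<omega> = p \<bullet> \<omega>"
    and "x \<in> closure D \<Longrightarrow> x \<noteq> p \<Longrightarrow> x \<bullet> \<omega> < p \<bullet> \<omega>"
proof -
  obtain q where q: "contact_set D \<omega> = {q}"
    using assms(3) by (auto simp: regular_direction_def is_singleton_def)
  then have pq: "p = q" by (simp add: p_def contact_point_def)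
  then have pc: "p \<in> contact_set D \<omega>" using q by simp
  then show sup: "support_fun D \<omega> = p \<bullet> \<omega>" by (simp add: contact_set_def)
  have "bounded ((\<lambda>x. x \<bullet> \<omega>) ` D)"
    using bounded_linear_image[OF assms(1) bounded_linear_inner_left] .
  then have "bdd_above ((\<lambda>x. x \<bullet> \<omega>) ` D)" by (rule bounded_imp_bdd_above)
  then have "D \<subseteq> {x. x \<bullet> \<omega> \<le> support_fun D \<omega>}"
    unfolding support_fun_def by (auto intro: cSUP_upper)
  moreover have "closed {x. x \<bullet> \<omega> \<le> support_fun D \<omega>}"
    by (intro closed_Collect_le continuous_intros)
  ultimately have "closure D \<subseteq> {x. x \<bullet> \<omega> \<le> support_fun D \<omega>}" by (rule closure_minimal)
  moreover assume "x \<in> closure D" "x \<noteq> p"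
  ultimately have "x \<bullet> \<omega> \<le> p \<bullet> \<omega>" "x \<notin> contact_set D \<omega>" using sup q pq by auto
  then show "x \<bullet> \<omega> < p \<bullet> \<omega>" using \<open>x \<in> closure D\<close> sup by (auto simp: contact_set_def)
qed

text \<open>
  A direction on the boundary of the cone becomes interior after tilting it slightly towards the axis
  \<open>- n\<close>, since \<open>cos \<theta> < 1\<close>; the tilted points lie in \<open>D\<close> and approximate the given one.
\<close>

lemma closed_cone_direction_in_closure:
  assumes n: "norm n = 1" and \<theta>: "0 < \<theta>" "\<theta> < pi / 2"
    and \<epsilon>: "\<epsilon> > 0" "D \<inter> ball p \<epsilon> = circular_cone p (- n) \<theta> \<inter> ball p \<epsilon>"
    and v: "v \<bullet> (- n) \<ge> norm v * cos \<theta>"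
  obtains r where "r > 0" "p + r *\<^sub>R v \<in> closure D"
proof -
  have cos1: "cos \<theta> < 1" "cos \<theta> > 0"
    using \<theta> cos_monotone_0_pi[of 0 \<theta>] by (auto intro: cos_gt_zero)
  define r where "r = \<epsilon> / (2 * (norm v + 1))"
  have nv: "norm v + 1 > 0" by (simp add: add_nonneg_pos)
  have r: "r > 0" using \<epsilon> nv by (simp add: r_def)
  have "p + r *\<^sub>R v \<in> closure D"
    unfolding closure_approachable
  proof (intro allI impI)
    fix e :: real assume e: "e > 0"
    define t where "t = min 1 (e / (2 * r))"
    have t: "0 < t" "t \<le> 1" "r * t < e"
      using e r by (auto simp: t_def min_def field_simps)
    define w where "w = v - t *\<^sub>R n"
    have wv: "norm w \<le> norm v + t"
      using norm_triangle_ineq4[of v "t *\<^sub>R n"] n t by (simp add: w_def)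
    have "norm w * cos \<theta> \<le> (norm v + t) * cos \<theta>"
      using wv cos1 by (intro mult_right_mono) auto
    also have "\<dots> < v \<bullet> (- n) + t"
      using v mult_strict_left_mono[OF cos1(1) t(1)] by (simp add: distrib_right)
    also have "\<dots> = w \<bullet> (- n)" using n by (simp add: w_def inner_diff_left norm_eq_1)
    finally have "p + w \<in> circular_cone p (- n) \<theta>" by (simp add: circular_cone_def)
    then have "p + r *\<^sub>R w \<in> circular_cone p (- n) \<theta>" using circular_cone_scale[OF r] by blast
    moreover have "p + r *\<^sub>R w \<in> ball p \<epsilon>"
    proof -
      have "r * norm w \<le> r * (norm v + 1)" using wv t r by (intro mult_left_mono) auto
      also have "\<dots> = \<epsilon> / 2"
      proof -
        have "\<epsilon> / (2 * k) * k = \<epsilon> / 2" if "k > 0" for k :: real using that by simp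
        from this[OF nv] show ?thesis by (simp only: r_def)
      qed
      also have "\<dots> < \<epsilon>" using \<epsilon> by simp
      finally show ?thesis using r by (simp add: dist_norm)
    qed
    ultimately have "p + r *\<^sub>R w \<in> D" using \<epsilon>(2) by blast
    moreover have "dist (p + r *\<^sub>R w) (p + r *\<^sub>R v) < e"
      using t r n by (simp add: w_def dist_norm scaleR_diff_right)
    ultimately show "\<exists>y\<in>D. dist y (p + r *\<^sub>R v) < e" by blast
  qed
  with r show ?thesis by (rule that)
qed

text \<open>
  Every direction of the closed cone leads to points of \<open>closure D\<close> other than the contact point, hence
  strictly below the supporting plane. Compactness of the set of unit directions makes this uniform.
\<close>

lemma contact_cone_below_plane:
  assumes D: "bounded D" "D \<noteq> {}" "regular_direction D \<omega>"
    and sing: "cone_singularity D (contact_point D \<omega>) n \<theta>"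
  shows "\<exists>\<kappa>>0. \<forall>v. norm v * cos \<theta> \<le> v \<bullet> (- n) \<longrightarrow> v \<bullet> \<omega> \<le> - \<kappa> * norm v"
proof -
  define p where "p = contact_point D \<omega>"
  obtain \<epsilon> where n: "norm n = 1" and \<theta>: "0 < \<theta>" "\<theta> < pi / 2"
    and \<epsilon>: "\<epsilon> > 0" "D \<inter> ball p \<epsilon> = circular_cone p (- n) \<theta> \<inter> ball p \<epsilon>"
    using sing by (auto simp: cone_singularity_def p_def)
  define K where "K = {v::real^3. norm v = 1 \<and> v \<bullet> (- n) \<ge> cos \<theta>}"
  have neg: "v \<bullet> \<omega> < 0" if "v \<in> K" for v
  proof -
    have v: "norm v = 1" "v \<bullet> (- n) \<ge> norm v * cos \<theta>" using that by (auto simp: K_def)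
    obtain r where r: "r > 0" "p + r *\<^sub>R v \<in> closure D"
      using closed_cone_direction_in_closure[OF n \<theta> \<epsilon> v(2)] .
    have "p + r *\<^sub>R v \<noteq> p" using r v(1) by auto
    then have "(p + r *\<^sub>R v) \<bullet> \<omega> < p \<bullet> \<omega>"
      using contact_point_strict_max(2)[OF D] r by (simp add: p_def)
    then show ?thesis using r by (simp add: inner_add_left mult_less_0_iff)
  qed
  have "K = sphere 0 1 \<inter> {v. v \<bullet> (- n) \<ge> cos \<theta>}" by (auto simp: K_def)
  moreover have "closed {v::real^3. v \<bullet> (- n) \<ge> cos \<theta>}"
    by (intro closed_Collect_le continuous_intros)
  ultimately have "compact K" by (simp add: compact_Int_closed)
  moreover have "- n \<in> K" using n by (simp add: K_def norm_eq_1)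
  then have "K \<noteq> {}" by auto
  moreover have "continuous_on K (\<lambda>v. v \<bullet> \<omega>)" by (intro continuous_intros)
  ultimately obtain v0 where v0: "v0 \<in> K" "\<forall>v\<in>K. v \<bullet> \<omega> \<le> v0 \<bullet> \<omega>"
    using continuous_attains_sup by blast
  define \<kappa> where "\<kappa> = - (v0 \<bullet> \<omega>)"
  have "\<kappa> > 0" using neg[OF v0(1)] by (simp add: \<kappa>_def)
  moreover have "v \<bullet> \<omega> \<le> - \<kappa> * norm v" if v: "v \<bullet> (- n) \<ge> norm v * cos \<theta>" for v
  proof (cases "v = 0")
    case False
    define u where "u = (1 / norm v) *\<^sub>R v"
    have vu: "v = norm v *\<^sub>R u" using False by (simp add: u_def)
    have "u \<bullet> (- n) \<ge> cos \<theta>"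
      using v False by (simp add: u_def field_simps)
    then have "u \<in> K" using False by (simp add: K_def u_def)
    then have "norm v * (u \<bullet> \<omega>) \<le> norm v * (- \<kappa>)"
      using v0(2) by (intro mult_left_mono) (auto simp: \<kappa>_def)
    moreover have "v \<bullet> \<omega> = norm v * (u \<bullet> \<omega>)" by (subst vu) simp
    ultimately show ?thesis by (simp add: mult.commute)
  qed simp
  ultimately show ?thesis by blast
qed

text \<open>
  The estimate is tested on the generator \<open>v\<close> of the closed cone that is closest to \<open>\<omega>\<close>, which lies in the
  plane of \<open>n\<close> and \<open>\<omega>\<close>. If these are parallel, that plane is undefined, but then the axis direction \<open>- n\<close>
  already decides.
\<close>

lemma contact_cone_axis:
  assumes D: "bounded D" "D \<noteq> {}" "regular_direction D \<omega>"
    and sing: "cone_singularity D (contact_point D \<omega>) n \<theta>" and \<omega>: "norm \<omega> = 1"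
  shows "n \<bullet> \<omega> > sin \<theta>"
proof -
  have n: "norm n = 1" and \<theta>: "0 < \<theta>" "\<theta> < pi / 2"
    using sing by (auto simp: cone_singularity_def)
  have trig: "cos \<theta> > 0" "sin \<theta> > 0" "sin \<theta> < 1"
    using \<theta> sin_monotone_2pi[of \<theta> "pi / 2"] by (auto intro: cos_gt_zero sin_gt_zero)
  obtain \<kappa> where \<kappa>: "\<kappa> > 0" "\<And>v. v \<bullet> (- n) \<ge> norm v * cos \<theta> \<Longrightarrow> v \<bullet> \<omega> \<le> - \<kappa> * norm v"
    using contact_cone_below_plane[OF D sing] by blast
  define c where "c = n \<bullet> \<omega>"
  define m where "m = \<omega> - c *\<^sub>R n"
  have ip: "n \<bullet> n = 1" "\<omega> \<bullet> \<omega> = 1" using n \<omega> by (auto simp: norm_eq_1)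
  have mn: "m \<bullet> n = 0" "n \<bullet> m = 0" and m\<omega>: "m \<bullet> \<omega> = 1 - c\<^sup>2" and mm: "m \<bullet> m = 1 - c\<^sup>2"
    using ip by (auto simp: m_def c_def inner_diff_left inner_diff_right inner_commute power2_eq_square)
  define v where "v = (sin \<theta>) *\<^sub>R m - (cos \<theta> * norm m) *\<^sub>R n"
  have "c > 0"
    using \<kappa>(2)[of "- n"] \<kappa>(1) n ip by (simp add: c_def)
  show ?thesis
  proof (cases "m = 0")
    case True
    then have "c\<^sup>2 = 1" using mm by simp
    then have "c = 1" using \<open>c > 0\<close> by (simp add: power2_eq_1_iff)
    then show ?thesis using trig by (simp add: c_def)
  next
    case False
    have m2: "norm m * norm m = 1 - c\<^sup>2" using mm by (metis power2_norm_eq_inner power2_eq_square)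
    have "norm v = norm m"
    proof -
      have "v \<bullet> v = (sin \<theta>)\<^sup>2 * (m \<bullet> m) + (cos \<theta>)\<^sup>2 * (norm m)\<^sup>2"
        by (simp add: v_def inner_diff_left inner_diff_right mn ip power2_eq_square mult_ac)
      also have "\<dots> = (norm m)\<^sup>2 * ((sin \<theta>)\<^sup>2 + (cos \<theta>)\<^sup>2)"
        unfolding power2_norm_eq_inner[symmetric] by (simp only: distrib_left mult.commute)
      finally have "v \<bullet> v = (norm m)\<^sup>2 * ((sin \<theta>)\<^sup>2 + (cos \<theta>)\<^sup>2)" .
      then have "v \<bullet> v = m \<bullet> m" by (simp add: power2_norm_eq_inner)
      then show ?thesis by (simp add: norm_eq_sqrt_inner)
    qed
    moreover have "v \<bullet> (- n) = norm m * cos \<theta>"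
      by (simp add: v_def inner_diff_left mn ip)
    ultimately have "v \<bullet> \<omega> \<le> - \<kappa> * norm m" using \<kappa>(2)[of v] by simp
    also have "\<dots> < 0" using \<kappa>(1) False by simp
    finally have "sin \<theta> * (norm m * norm m) < norm m * (cos \<theta> * c)"
      by (simp add: v_def inner_diff_left m\<omega> m2 c_def algebra_simps)
    then have "norm m * (sin \<theta> * norm m) < norm m * (cos \<theta> * c)" by (simp add: mult_ac)
    then have "sin \<theta> * norm m < cos \<theta> * c"
      by (rule mult_left_less_imp_less) simp
    then have "(sin \<theta> * norm m)\<^sup>2 < (cos \<theta> * c)\<^sup>2"
      using trig by (intro power_strict_mono) auto
    then have "(sin \<theta>)\<^sup>2 * (1 - c\<^sup>2) < (1 - (sin \<theta>)\<^sup>2) * c\<^sup>2"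
      using m2 by (simp add: power_mult_distrib power2_eq_square[of "norm m"] cos_squared_eq)
    then have "(sin \<theta>)\<^sup>2 < c\<^sup>2" by (simp add: algebra_simps)
    then show ?thesis using \<open>c > 0\<close> power2_less_imp_less[of "sin \<theta>" c] by (simp add: c_def)
  qed
qed

text \<open>
  Outside a ball around the contact point, compactness keeps \<open>D\<close> a positive distance below the supporting
  plane; inside the slab the uniform estimate keeps the cone in the ball, where it agrees with \<open>D\<close>. This
  existence is what makes the description of the indicator function by all admissible depths
  meaningful.
\<close>

lemma admissible_depth_exists:
  assumes D: "bounded D" "D \<noteq> {}" "regular_direction D \<omega>"
    and sing: "cone_singularity D (contact_point D \<omega>) n \<theta>"
  shows "\<exists>\<delta>. admissible_depth D \<omega> n \<theta> \<delta>"
proof -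
  define p where "p = contact_point D \<omega>"
  note max = contact_point_strict_max[OF D, folded p_def]
  obtain \<epsilon> where \<epsilon>: "\<epsilon> > 0" "D \<inter> ball p \<epsilon> = circular_cone p (- n) \<theta> \<inter> ball p \<epsilon>"
    using sing by (auto simp: cone_singularity_def p_def)
  obtain \<kappa> where \<kappa>: "\<kappa> > 0" "\<And>v. v \<bullet> (- n) \<ge> norm v * cos \<theta> \<Longrightarrow> v \<bullet> \<omega> \<le> - \<kappa> * norm v"
    using contact_cone_below_plane[OF D sing] by blast
  have "compact (closure D - ball p \<epsilon>)" using D(1) by (intro compact_diff) auto
  have "\<exists>h<p \<bullet> \<omega>. \<forall>x\<in>closure D - ball p \<epsilon>. x \<bullet> \<omega> \<le> h"
  proof (cases "closure D - ball p \<epsilon> = {}")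
    case True
    then show ?thesis by (intro exI[of _ "p \<bullet> \<omega> - 1"]) auto
  next
    case False
    obtain x0 where x0: "x0 \<in> closure D - ball p \<epsilon>" "\<forall>x\<in>closure D - ball p \<epsilon>. x \<bullet> \<omega> \<le> x0 \<bullet> \<omega>"
      using continuous_attains_sup[OF \<open>compact _\<close> False continuous_on_inner[OF continuous_on_id continuous_on_const]]
      by blast
    have "x0 \<noteq> p" using x0 \<epsilon>(1) by auto
    then show ?thesis using max(2)[of x0] x0 by auto
  qed
  then obtain h where h: "h < p \<bullet> \<omega>" "\<And>x. x \<in> closure D \<Longrightarrow> x \<notin> ball p \<epsilon> \<Longrightarrow> x \<bullet> \<omega> \<le> h" by auto
  define \<delta> where "\<delta> = min (p \<bullet> \<omega> - h) (\<kappa> * \<epsilon>)"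
  have \<delta>: "\<delta> > 0" using h \<kappa> \<epsilon> by (simp add: \<delta>_def)
  let ?S = "{x. p \<bullet> \<omega> - \<delta> < x \<bullet> \<omega> \<and> x \<bullet> \<omega> < p \<bullet> \<omega>}"
  have D_ball: "x \<in> ball p \<epsilon>" if "x \<in> D" "x \<in> ?S" for x
  proof (rule ccontr)
    assume "x \<notin> ball p \<epsilon>"
    then have "x \<bullet> \<omega> \<le> h" using h(2) that(1) closure_subset by blast
    then show False using that(2) by (auto simp: \<delta>_def)
  qed
  have cone_ball: "x \<in> ball p \<epsilon>" if "x \<in> circular_cone p (- n) \<theta>" "x \<in> ?S" for x
  proof -
    have "(x - p) \<bullet> \<omega> \<le> - \<kappa> * norm (x - p)"
      using that(1) by (intro \<kappa>(2)) (simp add: circular_cone_def)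
    then have "\<kappa> * norm (x - p) < \<kappa> * \<epsilon>" using that(2) by (auto simp: inner_diff_left \<delta>_def)
    then show ?thesis using \<kappa>(1) by (simp add: dist_norm norm_minus_commute)
  qed
  have "D \<inter> ?S = circular_cone p (- n) \<theta> \<inter> ?S"
    using D_ball cone_ball \<epsilon>(2) by blast
  then have "admissible_depth D \<omega> n \<theta> \<delta>"
    unfolding admissible_depth_def p_def[symmetric] max(1) conical_region_cone_slice[OF \<delta>]
    using \<delta> by simp
  then show ?thesis ..
qed

lemma I_fun_cone:
  assumes D: "bounded D" "D \<noteq> {}" "regular_direction D \<omega>"
    and sing: "cone_singularity D (contact_point D \<omega>) n \<theta>" and \<omega>: "norm \<omega> = 1"
    and \<xi>: "\<xi> \<in> orthogonal_circle \<omega>"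
  shows "I_fun D f n \<theta> \<omega> \<xi> = f (contact_point D \<omega>) * of_real (6 * cone_volume \<theta>) /
     (of_real (n \<bullet> \<omega>) + \<i> * of_real (n \<bullet> \<xi>)) ^ 3"
  unfolding I_fun_def
proof (rule the_equality)
  define p where "p = contact_point D \<omega>"
  have n: "norm n = 1" and \<theta>: "0 < \<theta>" "\<theta> < pi / 2"
    using sing by (auto simp: cone_singularity_def)
  have val: "f p * C_coeff p \<omega> \<delta> (cone_slice p n \<theta> \<omega> \<delta>) \<xi> = f p * of_real (6 * cone_volume \<theta>) /
     (of_real (n \<bullet> \<omega>) + \<i> * of_real (n \<bullet> \<xi>)) ^ 3" if "\<delta> > 0" for \<delta>
    using C_coeff_cone[OF \<omega> n \<theta> contact_cone_axis[OF D sing \<omega>] \<xi> that] by simp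
  show "\<forall>\<delta>. admissible_depth D \<omega> n \<theta> \<delta> \<longrightarrow> f (contact_point D \<omega>) *
        C_coeff (contact_point D \<omega>) \<omega> \<delta> (cone_slice (contact_point D \<omega>) n \<theta> \<omega> \<delta>) \<xi> =
      f (contact_point D \<omega>) * of_real (6 * cone_volume \<theta>) / (of_real (n \<bullet> \<omega>) + \<i> * of_real (n \<bullet> \<xi>)) ^ 3"
    using val by (simp add: admissible_depth_def p_def)
  fix c assume c: "\<forall>\<delta>. admissible_depth D \<omega> n \<theta> \<delta> \<longrightarrow> f (contact_point D \<omega>) *
        C_coeff (contact_point D \<omega>) \<omega> \<delta> (cone_slice (contact_point D \<omega>) n \<theta> \<omega> \<delta>) \<xi> = c"
  obtain \<delta> where \<delta>: "admissible_depth D \<omega> n \<theta> \<delta>" using admissible_depth_exists[OF D sing] by blast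
  then have "\<delta> > 0" by (simp add: admissible_depth_def)
  then show "c = f (contact_point D \<omega>) * of_real (6 * cone_volume \<theta>) / (of_real (n \<bullet> \<omega>) + \<i> * of_real (n \<bullet> \<xi>)) ^ 3"
    using c \<delta> val by (auto simp: p_def)
qed

section \<open>Integrals along the great circle and the conclusion\<close>

lemma exists_orthogonal_circle_orthogonal:
  assumes "norm \<omega> = 1"
  obtains \<xi> where "\<xi> \<in> orthogonal_circle \<omega>" "n \<bullet> \<xi> = 0"
proof -
  have "dim {\<omega>, n} < DIM(real^3)"
    using dim_le_card'[of "{\<omega>, n}"] card_insert_le_m1[of 2 "{n}" \<omega>] by simp
  then obtain x where x: "x \<noteq> 0" "\<And>y. y \<in> span {\<omega>, n} \<Longrightarrow> orthogonal x y"
    using orthogonal_to_subspace_exists[of "{\<omega>, n}"] by (metis)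
  have "\<omega> \<bullet> x = 0" "n \<bullet> x = 0"
    using x(2)[of \<omega>] x(2)[of n] by (auto simp: span_base orthogonal_def inner_commute)
  then show ?thesis
    using that[of "(1 / norm x) *\<^sub>R x"] x(1) by (simp add: orthogonal_circle_def)
qed

text \<open>
  The frame comes from the definition of the arc length measure and cannot be prescribed here, but for
  Laplace's integral any frame will do.
\<close>

lemma integral_arc_length_measure:
  fixes f :: "real^3 \<Rightarrow> complex"
  assumes \<omega>: "norm \<omega> = 1" and f: "continuous_on UNIV f"
  obtains a b where "normal_frame \<omega> a b"
    and "(LINT \<xi>:orthogonal_circle \<omega>|arc_length_measure \<omega>. f \<xi>) =
      integral {0..2 * pi} (\<lambda>t. f (cos t *\<^sub>R a + sin t *\<^sub>R b))"
proof -
  obtain \<xi> where "\<xi> \<in> orthogonal_circle \<omega>"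
    using exists_orthogonal_circle_orthogonal[OF \<omega>] .
  then obtain a b where ch: "chosen_frame \<omega> = (a, b)" and F: "normal_frame \<omega> a b"
    using chosen_frame_normal normal_frame_cross3[OF \<omega>] by (metis (no_types, lifting) case_prodE)
  have ip: "a \<bullet> a = 1" "b \<bullet> b = 1" "a \<bullet> b = 0" "b \<bullet> a = 0" "\<omega> \<bullet> a = 0" "\<omega> \<bullet> b = 0"
    using F by (auto simp: normal_frame_def orthogonal_circle_def norm_eq_1 inner_commute)
  define g where "g t = cos t *\<^sub>R a + sin t *\<^sub>R b" for t
  have g: "g t \<in> orthogonal_circle \<omega>" for t
    by (simp add: orthogonal_circle_def g_def norm_eq_1 inner_add_left inner_add_right ip
        power2_eq_square[symmetric])
  have contg: "continuous_on T g" for T unfolding g_def by (intro continuous_intros)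
  have mg: "g \<in> borel_measurable (restrict_space lborel {0..<2 * pi})"
    by (intro measurable_restrict_space1) (simp add: borel_measurable_continuous_onI contg)
  have "closed (orthogonal_circle \<omega>)"
  proof -
    have "orthogonal_circle \<omega> = sphere 0 1 \<inter> {\<xi>. \<omega> \<bullet> \<xi> = 0}" by (auto simp: orthogonal_circle_def)
    then show ?thesis by (auto intro!: closed_Collect_eq continuous_intros)
  qed
  then have "orthogonal_circle \<omega> \<in> sets borel" by simp
  then have m: "(\<lambda>\<xi>. indicat_real (orthogonal_circle \<omega>) \<xi> *\<^sub>R f \<xi>) \<in> borel_measurable borel"
    using borel_measurable_continuous_onI[OF f]
    by (intro borel_measurable_scaleR borel_measurable_indicator)
  have "arc_length_measure \<omega> = distr (restrict_space lborel {0..<2 * pi}) borel g"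
    by (simp add: arc_length_measure_def ch g_def[abs_def])
  then have "(LINT \<xi>:orthogonal_circle \<omega>|arc_length_measure \<omega>. f \<xi>)
     = (LINT t|restrict_space lborel {0..<2 * pi}. indicat_real (orthogonal_circle \<omega>) (g t) *\<^sub>R f (g t))"
    unfolding set_lebesgue_integral_def using integral_distr[OF mg m] by simp
  also have "\<dots> = (LINT t:{0..<2 * pi}|lborel. f (g t))"
    using g by (simp add: integral_restrict_space set_lebesgue_integral_def)
  also have "\<dots> = (LINT t:{0..2 * pi}|lborel. f (g t))"
    unfolding set_lebesgue_integral_def
  proof (rule integral_cong_AE)
    have mfg: "(\<lambda>t. f (g t)) \<in> borel_measurable borel"
      by (intro borel_measurable_continuous_onI continuous_on_compose2[OF f contg]) auto
    show "(\<lambda>t. indicat_real {0..<2 * pi} t *\<^sub>R f (g t)) \<in> borel_measurable lborel"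
      "(\<lambda>t. indicat_real {0..2 * pi} t *\<^sub>R f (g t)) \<in> borel_measurable lborel"
      using mfg by measurable
    show "AE t in lborel. indicat_real {0..<2 * pi} t *\<^sub>R f (g t) = indicat_real {0..2 * pi} t *\<^sub>R f (g t)"
      using AE_lborel_singleton[of "2 * pi"] by eventually_elim (auto simp: indicator_def)
  qed
  also have "\<dots> = integral {0..2 * pi} (\<lambda>t. f (g t))"
  proof (rule set_borel_integral_eq_integral(2))
    show "set_integrable lborel {0..2 * pi} (\<lambda>t. f (g t))"
      unfolding set_integrable_def
      by (intro borel_integrable_compact continuous_on_compose2[OF f contg]) auto
  qed
  finally show ?thesis using that[OF F] by (simp add: g_def)
qed

theorem corollary1p4:
  fixes \<Omega> D :: "(real^3) set"
    and k \<theta> \<eta> \<alpha> :: real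
    and \<rho> \<rho>' u :: "real^3 \<Rightarrow> complex"
    and \<omega> n :: "real^3"
  assumes "open \<Omega>" "connected \<Omega>" "\<Omega> \<noteq> {}" "bounded \<Omega>" "C2_boundary \<Omega>"
    and "k \<ge> 0"
    and "open D" "D \<noteq> {}" "closure D \<subseteq> \<Omega>"
    and "L2_on D \<rho>"
    and "weak_helmholtz_solution \<Omega> k (source \<rho> D) u"
    and "\<omega> \<in> sphere 0 1" "regular_direction D \<omega>"
    and "cone_singularity D (contact_point D \<omega>) n \<theta>"
    and "\<eta> > 0" "0 < \<alpha>" "\<alpha> \<le> 1"
    and "holder_on \<alpha> (cball (contact_point D \<omega>) \<eta>) \<rho>'"
    and "AE x in lebesgue. x \<in> ball (contact_point D \<omega>) \<eta> \<inter> D \<longrightarrow> \<rho> x = \<rho>' x"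
  shows "(\<rho>' (contact_point D \<omega>) \<noteq> 0 \<longrightarrow>
            (\<omega> = n \<longleftrightarrow> I_fun D \<rho>' n \<theta> \<omega> constant_on orthogonal_circle \<omega>))
       \<and> (\<exists>\<xi>\<^sub>0 \<in> orthogonal_circle \<omega>.
            (\<forall>\<xi> \<in> orthogonal_circle \<omega>.
               cmod (I_fun D \<rho>' n \<theta> \<omega> \<xi>) \<le> cmod (I_fun D \<rho>' n \<theta> \<omega> \<xi>\<^sub>0)) \<and>
            6 * cmod (\<rho>' (contact_point D \<omega>)) * cone_volume \<theta>
              = (n \<bullet> \<omega>) ^ 3 * cmod (I_fun D \<rho>' n \<theta> \<omega> \<xi>\<^sub>0))
       \<and> 6 * \<rho>' (contact_point D \<omega>) * complex_of_real (cone_volume \<theta> * (3 * (n \<bullet> \<omega>)\<^sup>2 - 1))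
           = complex_of_real (1 / pi) *
             (LINT \<xi>:orthogonal_circle \<omega>|arc_length_measure \<omega>. I_fun D \<rho>' n \<theta> \<omega> \<xi>)"
proof -
  define c where "c = n \<bullet> \<omega>"
  define A where "A = \<rho>' (contact_point D \<omega>) * of_real (6 * cone_volume \<theta>)"
  define J where "J \<xi> = A / (of_real c + \<i> * of_real (n \<bullet> \<xi>)) ^ 3" for \<xi>
  have \<omega>: "norm \<omega> = 1" using assms by simp
  have n: "norm n = 1" and \<theta>: "0 < \<theta>" "\<theta> < pi / 2"
    using \<open>cone_singularity _ _ _ _\<close> by (auto simp: cone_singularity_def)
  have "bounded D"
    using \<open>bounded \<Omega>\<close> \<open>closure D \<subseteq> \<Omega>\<close> closure_subset by (meson bounded_subset)
  note D = this \<open>D \<noteq> {}\<close> \<open>regular_direction D \<omega>\<close> \<open>cone_singularity _ _ _ _\<close> \<omega>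
  have I: "I_fun D \<rho>' n \<theta> \<omega> \<xi> = J \<xi>" if "\<xi> \<in> orthogonal_circle \<omega>" for \<xi>
    using I_fun_cone[OF D that] by (simp add: J_def A_def c_def)
  have "sin \<theta> > 0" "cos \<theta> > 0" using \<theta> by (auto intro: sin_gt_zero cos_gt_zero)
  then have V: "cone_volume \<theta> > 0" by (simp add: cone_volume_def)
  have c: "c > 0" using contact_cone_axis[OF D] \<open>sin \<theta> > 0\<close> by (simp add: c_def)
  have den: "of_real c + \<i> * of_real x \<noteq> (0::complex)" for x
    using c by (auto simp: complex_eq_iff)
  obtain \<xi>0 where \<xi>0: "\<xi>0 \<in> orthogonal_circle \<omega>" "n \<bullet> \<xi>0 = 0"
    using exists_orthogonal_circle_orthogonal[OF \<omega>] .
  have cmodJ: "cmod (J \<xi>) = cmod A / cmod (of_real c + \<i> * of_real (n \<bullet> \<xi>)) ^ 3" for \<xi>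
    by (simp add: J_def norm_divide norm_power)
  have cmod_den: "cmod (of_real c + \<i> * of_real x) = sqrt (c\<^sup>2 + x\<^sup>2)" for x
    by (simp add: cmod_def)
  have J0: "cmod (J \<xi>0) = cmod A / c ^ 3"
    unfolding cmodJ cmod_den using \<xi>0 c by simp

  \<comment> \<open>Constancy forces \<open>\<bar>c + \<i> n \<bullet> \<xi>\<bar>\<close> to equal its value \<open>c\<close> at \<open>\<xi>0\<close>, so \<open>n\<close> is orthogonal to the whole circle.\<close>
  have const: "\<omega> = n \<longleftrightarrow> I_fun D \<rho>' n \<theta> \<omega> constant_on orthogonal_circle \<omega>"
    if \<rho>: "\<rho>' (contact_point D \<omega>) \<noteq> 0"
  proof
    assume "\<omega> = n"
    then have "n \<bullet> \<xi> = 0" if "\<xi> \<in> orthogonal_circle \<omega>" for \<xi>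
      using that by (simp add: orthogonal_circle_def)
    then have "I_fun D \<rho>' n \<theta> \<omega> \<xi> = A / of_real c ^ 3" if "\<xi> \<in> orthogonal_circle \<omega>" for \<xi>
      using I[OF that] that by (simp add: J_def)
    then show "I_fun D \<rho>' n \<theta> \<omega> constant_on orthogonal_circle \<omega>"
      unfolding constant_on_def by blast
  next
    assume "I_fun D \<rho>' n \<theta> \<omega> constant_on orthogonal_circle \<omega>"
    then have eq: "J \<xi> = J \<xi>0" if "\<xi> \<in> orthogonal_circle \<omega>" for \<xi>
      using I that \<xi>0 unfolding constant_on_def by metis
    have A: "A \<noteq> 0" using \<rho> V by (simp add: A_def)
    have orth: "n \<bullet> \<xi> = 0" if \<xi>: "\<xi> \<in> orthogonal_circle \<omega>" for \<xi>
    proof -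
      have "cmod A / sqrt (c\<^sup>2 + (n \<bullet> \<xi>)\<^sup>2) ^ 3 = cmod A / c ^ 3"
        unfolding J0[symmetric] eq[OF \<xi>, symmetric] cmodJ cmod_den ..
      moreover have "x = y" if "cmod A / x = cmod A / y" for x y
        using that A by (simp only: divide_cancel_left norm_eq_zero simp_thms)
      ultimately have "sqrt (c\<^sup>2 + (n \<bullet> \<xi>)\<^sup>2) ^ 3 = c ^ 3" by blast
      then have "sqrt (c\<^sup>2 + (n \<bullet> \<xi>)\<^sup>2) = c"
        by (rule power_eq_imp_eq_base) (use c in simp_all)
      moreover have "c\<^sup>2 + (n \<bullet> \<xi>)\<^sup>2 = (sqrt (c\<^sup>2 + (n \<bullet> \<xi>)\<^sup>2))\<^sup>2" by simp
      ultimately show ?thesis by simp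
    qed
    have F: "normal_frame \<omega> \<xi>0 (cross3 \<omega> \<xi>0)" by (rule normal_frame_cross3[OF \<omega> \<xi>0(1)])
    then have "n \<bullet> cross3 \<omega> \<xi>0 = 0" by (intro orth) (simp add: normal_frame_def)
    then have nc: "n = c *\<^sub>R \<omega>"
      using normal_frame_expansion[OF \<omega> F, of n] \<xi>0(2) by (simp add: c_def)
    then have "norm n = \<bar>c\<bar> * norm \<omega>" by (metis norm_scaleR)
    then have "c = 1" using n \<omega> c by simp
    then show "\<omega> = n" using nc by simp
  qed
  have max: "cmod (J \<xi>) \<le> cmod (J \<xi>0)" for \<xi>
  proof -
    have "c ^ 3 \<le> sqrt (c\<^sup>2 + (n \<bullet> \<xi>)\<^sup>2) ^ 3"
      using c by (intro power_mono real_le_rsqrt) auto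
    then show ?thesis
      unfolding J0 cmodJ[of \<xi>] cmod_den using c by (intro divide_left_mono mult_pos_pos) (auto intro!: add_pos_nonneg)
  qed
  have "6 * cmod (\<rho>' (contact_point D \<omega>)) * cone_volume \<theta> = c ^ 3 * cmod (J \<xi>0)"
    unfolding J0 A_def using c V by (simp add: norm_mult)

  have contJ: "continuous_on UNIV J"
    unfolding J_def using den by (intro continuous_intros) auto
  obtain a b where F: "normal_frame \<omega> a b" and
    L: "(LINT \<xi>:orthogonal_circle \<omega>|arc_length_measure \<omega>. J \<xi>) =
      integral {0..2 * pi} (\<lambda>t. J (cos t *\<^sub>R a + sin t *\<^sub>R b))"
    using integral_arc_length_measure[OF \<omega> contJ] .
  have nn: "c\<^sup>2 + (n \<bullet> a)\<^sup>2 + (n \<bullet> b)\<^sup>2 = 1"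
  proof -
    have "n \<bullet> n = n \<bullet> ((n \<bullet> \<omega>) *\<^sub>R \<omega> + (n \<bullet> a) *\<^sub>R a + (n \<bullet> b) *\<^sub>R b)"
      using normal_frame_expansion[OF \<omega> F, of n] by simp
    then show ?thesis using n by (simp add: norm_eq_1 inner_add_right power2_eq_square c_def)
  qed
  then have "(1::complex)\<^sup>2 = (of_real c)\<^sup>2 + of_real ((n \<bullet> a)\<^sup>2 + (n \<bullet> b)\<^sup>2)"
    by (metis add.assoc of_real_1 of_real_add of_real_power one_power2)
  \<comment> \<open>Laplace's integral, with \<open>Z = 1\<close> because \<open>n\<close> is a unit vector.\<close>
  from has_integral_inverse_powers_angular(2)[OF _ _ this] c
  have "((\<lambda>t. A * (1 / (of_real c + \<i> * of_real ((n \<bullet> a) * cos t + (n \<bullet> b) * sin t)) ^ 3)) has_integral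
      A * (of_real pi * (3 * (of_real c)\<^sup>2 - 1))) {0..2 * pi}"
    by (intro has_integral_mult_right) simp
  then have "((\<lambda>t. J (cos t *\<^sub>R a + sin t *\<^sub>R b)) has_integral
      A * (of_real pi * (3 * (of_real c)\<^sup>2 - 1))) {0..2 * pi}"
    by (simp add: J_def inner_add_right mult.commute)
  moreover have "(LINT \<xi>:orthogonal_circle \<omega>|arc_length_measure \<omega>. I_fun D \<rho>' n \<theta> \<omega> \<xi>)
      = (LINT \<xi>:orthogonal_circle \<omega>|arc_length_measure \<omega>. J \<xi>)"
    unfolding set_lebesgue_integral_def
    by (intro Bochner_Integration.integral_cong) (auto simp: indicator_def I)
  ultimately have "(LINT \<xi>:orthogonal_circle \<omega>|arc_length_measure \<omega>. I_fun D \<rho>' n \<theta> \<omega> \<xi>)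
      = A * (of_real pi * (3 * (of_real c)\<^sup>2 - 1))"
    using L by (simp add: integral_unique)
  then have mean: "6 * \<rho>' (contact_point D \<omega>) * complex_of_real (cone_volume \<theta> * (3 * (n \<bullet> \<omega>)\<^sup>2 - 1))
           = complex_of_real (1 / pi) *
             (LINT \<xi>:orthogonal_circle \<omega>|arc_length_measure \<omega>. I_fun D \<rho>' n \<theta> \<omega> \<xi>)"
    by (simp add: A_def c_def)
  show ?thesis
    using const max \<open>6 * cmod _ * _ = _\<close> mean \<xi>0(1) I unfolding c_def by auto
qed

end
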